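(* Let $u,\psi\in\mathcal{H}(\mathbb{C})$ be such that $\psi$ is not a constant, let $1\leq p\leq\infty$ and $n\in\{0,1,2,\dots\}$. Let $D_{(u,\psi,n)}$ be bounded on $\mathcal{F}_p$, and hence $\psi(z)=az+b$ for some $a,b\in\mathbb{C}$ with $|a|\leq1$. Then the following statements are equivalent. (i) $L_{(u,\psi,n)}$ is essentially bounded away from zero on $\mathbb{C}$; (ii) $D_{(u,\psi,n)}$ is surjective (as an operator on $\mathcal{F}_p$); (iii) $|a|=1$.
   Context: $\mathcal{H}(\mathbb{C})$ denotes the set of entire functions on $\mathbb{C}$ and $A$ is the Lebesgue area measure. The Fock space is $\mathcal{F}_p=\{f\in\mathcal{H}(\mathbb{C}):\|f\|_p<\infty\}$, where $\|f\|_p=\big(\frac{p}{2\pi}\int_{\mathbb{C}}|f(z)|^pe^{-\frac p2|z|^2}dA(z)\big)^{1/p}$ for $1\leq p<\infty$ and $\|f\|_\infty=\sup_{z\in\mathbb{C}}|f(z)|e^{-\frac12|z|^2}$. For $u,\psi\in\mathcal{H}(\mathbb{C})$ and $n\in\{0,1,2,\dots\}$, the weighted composition–differentiation operator is $D_{(u,\psi,n)}f=u\cdot(f^{(n)}\circ\psi)$, where $f^{(n)}$ is the $n$-th derivative and $f^{(0)}=f$, and $$L_{(u,\psi,n)}(z)=|u(z)|\,|\psi(z)|^n\,e^{\frac12(|\psi(z)|^2-|z|^2)},\qquad z\in\mathbb{C}.$$ A non-zero function $g$ on $\mathbb{C}$ is essentially bounded away from zero if there exists a constant $\delta>0$ such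 that the set $\{z\in\mathbb{C}:|g(z)|<\delta\}$ has measure zero.
   Formalization: The formal statement additionally assumes that u is not identically zero; for u = 0 and ψ(z) = z the operator is bounded and |a| = 1, but (i) and (ii) fail, and for u = 0 the form ψ(z) = az + b need not follow. *)

theory Defs
  imports "HOL-Complex_Analysis.Complex_Analysis"
begin

(* The norm takes values in [0, \<infinity>], so that membership in the Fock space is finiteness
   of the norm.  The exponent p is only meant for 1 \<le> p \<le> \<infinity>.  On ennreal there is no
   real power, so the p-th root of the integral is taken on the reals when it is finite. *)
definition fock_norm :: "ennreal \<Rightarrow> (complex \<Rightarrow> complex) \<Rightarrow> ennreal" where
  "fock_norm p f =
     (if p = \<infinity> then (SUP z. ennreal (norm (f z) * exp (- (1/2) * (norm z)\<^sup>2)))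
      else let q = enn2real p;
               I = ennreal (q / (2 * pi)) *
                   (\<integral>\<^sup>+ z. ennreal (norm (f z) powr q * exp (- (q/2) * (norm z)\<^sup>2)) \<partial>lborel)
           in if I = \<infinity> then \<infinity> else ennreal (enn2real I powr (1/q)))"

definition fock_space :: "ennreal \<Rightarrow> (complex \<Rightarrow> complex) set" where
  "fock_space p = {f. f holomorphic_on UNIV \<and> fock_norm p f < \<infinity>}"

definition wcomp_diff ::
  "(complex \<Rightarrow> complex) \<Rightarrow> (complex \<Rightarrow> complex) \<Rightarrow> nat \<Rightarrow> (complex \<Rightarrow> complex) \<Rightarrow> complex \<Rightarrow> complex"
  where
  "wcomp_diff u \<psi> n f = (\<lambda>z. u z * (deriv ^^ n) f (\<psi> z))"

definition bounded_on_fock ::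
  "ennreal \<Rightarrow> ((complex \<Rightarrow> complex) \<Rightarrow> complex \<Rightarrow> complex) \<Rightarrow> bool" where
  "bounded_on_fock p T \<longleftrightarrow>
     (\<forall>f\<in>fock_space p. T f \<in> fock_space p) \<and>
     (\<exists>C::real. \<forall>f\<in>fock_space p. fock_norm p (T f) \<le> ennreal C * fock_norm p f)"

definition surjective_on_fock ::
  "ennreal \<Rightarrow> ((complex \<Rightarrow> complex) \<Rightarrow> complex \<Rightarrow> complex) \<Rightarrow> bool" where
  "surjective_on_fock p T \<longleftrightarrow> T ` fock_space p = fock_space p"

definition L_fun ::
  "(complex \<Rightarrow> complex) \<Rightarrow> (complex \<Rightarrow> complex) \<Rightarrow> nat \<Rightarrow> complex \<Rightarrow> real" where
  "L_fun u \<psi> n z =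
     norm (u z) * norm (\<psi> z) ^ n * exp (1/2 * ((norm (\<psi> z))\<^sup>2 - (norm z)\<^sup>2))"

(* A function with this property is automatically not identically zero. *)
definition ess_bounded_away_from_zero :: "(complex \<Rightarrow> real) \<Rightarrow> bool" where
  "ess_bounded_away_from_zero g \<longleftrightarrow> (\<exists>\<delta>>0. {z. \<bar>g z\<bar> < \<delta>} \<in> null_sets lebesgue)"

end

theory Submission
  imports Defs "HOL-Probability.Probability" "HOL-Real_Asymp.Real_Asymp"
begin

text \<open>Applying the operator to the normalised kernels \<open>exp (cnj w z - |w|^2/2)\<close>, which all have the
  same norm, and using the pointwise bound \<open>|f z| \<le> K \<parallel>f\<parallel> exp (|z|^2/2)\<close> gives
  \<open>|u z| |w|^n exp (Re (cnj w * \<psi> z)) \<le> C exp (|w|^2/2 + |z|^2/2)\<close> for all \<open>z\<close> and \<open>w\<close>.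
  Choosing \<open>w\<close> as a multiple of \<open>z^k\<close> on large circles bounds the Taylor coefficients of \<open>\<psi>\<close> and yields
  \<open>\<psi> z = a z + b\<close> with \<open>|a| \<le> 1\<close>. If \<open>|a| = 1\<close>, the choice \<open>w = \<psi> z\<close> bounds the entire function
  \<open>u z * \<psi> z ^ n * exp (a cnj b z)\<close>, so it is a non-zero constant; this forces \<open>n = 0\<close>, makes \<open>L\<close> constant,
  and the operator is a multiple of a surjective isometry. If \<open>|a| < 1\<close>, either of the other two
  conditions makes \<open>u\<close> zero-free, so by the maximum principle for \<open>1/u\<close> every circle around the origin
  contains a point with \<open>|u z| \<le> |u 0|\<close>. At these points \<open>L\<close> tends to \<open>0\<close>, and a Gaussian
  \<open>exp (c/2 * (cnj \<rho> z)^2)\<close> with \<open>|a|^2 < c < 1\<close> and \<open>\<rho>\<close> a limit direction of the points is too large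
  to be in the range.\<close>

section \<open>Area measure on the complex plane\<close>

text \<open>Both measures give a box the product of its side lengths, and this determines Lebesgue
  measure. Tonelli's theorem in real and imaginary parts becomes available.\<close>

lemma lborel_complex_eq_distr:
  "(lborel :: complex measure) = distr (lborel \<Otimes>\<^sub>M lborel) borel (\<lambda>(x, y). Complex x y)"
proof (rule lborel_eqI)
  fix l u :: complex
  assume le: "\<And>b. b \<in> Basis \<Longrightarrow> l \<bullet> b \<le> u \<bullet> b"
  have m: "(\<lambda>(x, y). Complex x y) \<in> borel_measurable (lborel \<Otimes>\<^sub>M lborel)"
    unfolding Complex_eq case_prod_beta by measurable
  have "(\<lambda>(x, y). Complex x y) -` box l u \<inter> space (lborel \<Otimes>\<^sub>M lborel)
      = {Re l<..<Re u} \<times> {Im l<..<Im u}"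
    by (auto simp: box_def Basis_complex_def space_pair_measure)
  moreover have "Re l \<le> Re u" "Im l \<le> Im u"
    using le[of 1] le[of \<i>] by (auto simp: Basis_complex_def)
  ultimately show "emeasure (distr (lborel \<Otimes>\<^sub>M lborel) borel (\<lambda>(x, y). Complex x y)) (box l u)
      = ennreal (\<Prod>b\<in>Basis. (u - l) \<bullet> b)"
    using m by (simp add: emeasure_distr lborel.emeasure_pair_measure_Times Basis_complex_def ennreal_mult)
qed simp

lemma nn_integral_lborel_complex:
  assumes [measurable]: "f \<in> borel_measurable borel"
  shows "(\<integral>\<^sup>+z. f z \<partial>lborel) = (\<integral>\<^sup>+x. \<integral>\<^sup>+y. f (Complex x y) \<partial>lborel \<partial>lborel)"
proof -
  have [measurable]: "(\<lambda>(x, y). Complex x y) \<in> borel_measurable (lborel \<Otimes>\<^sub>M lborel)"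
    unfolding Complex_eq case_prod_beta by measurable
  show ?thesis
    by (subst lborel_complex_eq_distr)
      (simp add: nn_integral_distr lborel.nn_integral_fst[symmetric])
qed

lemma nn_integral_lborel_complex':
  assumes [measurable]: "f \<in> borel_measurable borel"
  shows "(\<integral>\<^sup>+z. f z \<partial>lborel) = (\<integral>\<^sup>+y. \<integral>\<^sup>+x. f (Complex x y) \<partial>lborel \<partial>lborel)"
proof -
  have [measurable]: "(\<lambda>(x, y). Complex x y) \<in> borel_measurable (lborel \<Otimes>\<^sub>M lborel)"
    unfolding Complex_eq case_prod_beta by measurable
  have "(\<integral>\<^sup>+y. \<integral>\<^sup>+x. f (Complex x y) \<partial>lborel \<partial>lborel) = (\<integral>\<^sup>+x. \<integral>\<^sup>+y. f (Complex x y) \<partial>lborel \<partial>lborel)"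
    by (rule lborel_pair.Fubini') simp
  then show ?thesis
    by (simp add: nn_integral_lborel_complex)
qed

lemma nn_integral_lborel_translate:
  fixes f :: "'a::euclidean_space \<Rightarrow> ennreal"
  assumes [measurable]: "f \<in> borel_measurable borel"
  shows "(\<integral>\<^sup>+x. f (c + x) \<partial>lborel) = (\<integral>\<^sup>+x. f x \<partial>lborel)"
  by (subst (2) lborel_distr_plus[symmetric, of c]) (simp add: nn_integral_distr)

text \<open>On each horizontal line the shear is a translation, by \<open>t * y\<close>, so the
  inner integral over the real part is unchanged.\<close>

lemma nn_integral_shear_Re:
  assumes [measurable]: "f \<in> borel_measurable borel"
  shows "(\<integral>\<^sup>+z. f (z + of_real (t * Im z)) \<partial>lborel) = (\<integral>\<^sup>+z. f z \<partial>lborel)"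
proof -
  have "(\<integral>\<^sup>+x. f (Complex x y + of_real (t * y)) \<partial>lborel) = (\<integral>\<^sup>+x. f (Complex x y) \<partial>lborel)" for y
    using nn_integral_lborel_translate[of "\<lambda>x. f (Complex x y)" "t * y"]
    by (simp add: Complex_eq ac_simps)
  then show ?thesis
    by (simp add: nn_integral_lborel_complex')
qed

lemma nn_integral_shear_Im:
  assumes [measurable]: "f \<in> borel_measurable borel"
  shows "(\<integral>\<^sup>+z. f (z + \<i> * of_real (t * Re z)) \<partial>lborel) = (\<integral>\<^sup>+z. f z \<partial>lborel)"
proof -
  have "(\<integral>\<^sup>+y. f (Complex x y + \<i> * of_real (t * x)) \<partial>lborel) = (\<integral>\<^sup>+y. f (Complex x y) \<partial>lborel)" for x
    using nn_integral_lborel_translate[of "\<lambda>y. f (Complex x y)" "t * x"]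
    by (simp add: Complex_eq algebra_simps)
  then show ?thesis
    by (simp add: nn_integral_lborel_complex)
qed

text \<open>A rotation by an angle other than \<open>\<pi>\<close> is a product of three shears, with the half-angle
  tangent as a parameter; the rotation by \<open>\<pi>\<close> is the square of the one by \<open>\<pi>/2\<close>.\<close>

lemma nn_integral_rotate:
  assumes [measurable]: "f \<in> borel_measurable borel" and c: "cmod c = 1"
  shows "(\<integral>\<^sup>+z. f (c * z) \<partial>lborel) = (\<integral>\<^sup>+z. f z \<partial>lborel)"
proof -
  have *: "(\<integral>\<^sup>+z. g (d * z) \<partial>lborel) = (\<integral>\<^sup>+z. g z \<partial>lborel)"
    if [measurable]: "g \<in> borel_measurable borel" and d: "cmod d = 1" "d \<noteq> -1" for g :: "complex \<Rightarrow> ennreal" and d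
  proof -
    \<comment> \<open>For \<open>d = cis \<theta>\<close> these are sin \<theta> and - tan
      (\<theta>/2); the denominator vanishes only for the excluded \<open>d = -1\<close>.\<close>
    define s where "s = Im d"
    define t where "t = - Im d / (1 + Re d)"
    have sq: "(Re d)\<^sup>2 + (Im d)\<^sup>2 = 1"
      using d(1) by (simp add: cmod_def)
    have "1 + Re d \<noteq> 0"
    proof
      assume "1 + Re d = 0"
      then have "Re d = -1" by simp
      with sq have "d = -1" by (simp add: complex_eq_iff)
      with d show False by simp
    qed
    have ts: "1 + t * s = Re d"
      using \<open>1 + Re d \<noteq> 0\<close> sq by (simp add: t_def s_def field_simps power2_eq_square)
    have tt: "t + t * (1 + s * t) = - Im d"
    proof -
      have "t + t * (1 + s * t) = t * (1 + Re d)"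
        using ts by (simp add: algebra_simps)
      then show ?thesis using \<open>1 + Re d \<noteq> 0\<close> by (simp add: t_def)
    qed
    define A where "A z = z + of_real (t * Im z)" for z :: complex
    define B where "B z = z + \<i> * of_real (s * Re z)" for z :: complex
    have [measurable]: "A \<in> borel_measurable borel" "B \<in> borel_measurable borel"
      unfolding A_def B_def by measurable
    have "A (B (A z)) = d * z" for z
    proof (rule complex_eqI)
      have "Re (A (B (A z))) = (1 + t * s) * Re z + (t + t * (1 + s * t)) * Im z"
        by (simp add: A_def B_def algebra_simps)
      then show "Re (A (B (A z))) = Re (d * z)"
        unfolding ts tt by simp
      have "Im (A (B (A z))) = s * Re z + (1 + t * s) * Im z"
        by (simp add: A_def B_def algebra_simps)
      then show "Im (A (B (A z))) = Im (d * z)"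
        unfolding ts by (simp add: s_def)
    qed
    then have "(\<integral>\<^sup>+z. g (d * z) \<partial>lborel) = (\<integral>\<^sup>+z. g (A (B (A z))) \<partial>lborel)"
      by simp
    also have "\<dots> = (\<integral>\<^sup>+z. g (A (B z)) \<partial>lborel)"
      using nn_integral_shear_Re[of "\<lambda>z. g (A (B z))" t] by (simp add: A_def)
    also have "\<dots> = (\<integral>\<^sup>+z. g (A z) \<partial>lborel)"
      using nn_integral_shear_Im[of "\<lambda>z. g (A z)" s] by (simp add: B_def)
    also have "\<dots> = (\<integral>\<^sup>+z. g z \<partial>lborel)"
      using nn_integral_shear_Re[of g t] by (simp add: A_def)
    finally show ?thesis .
  qed
  show ?thesis
  proof (cases "c = -1")
    case True
    have "(\<integral>\<^sup>+z. f (c * z) \<partial>lborel) = (\<integral>\<^sup>+z. f (\<i> * (\<i> * z)) \<partial>lborel)"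
      by (simp add: True flip: mult.assoc)
    also have "\<dots> = (\<integral>\<^sup>+z. f (\<i> * z) \<partial>lborel)"
      by (rule *[of "\<lambda>z. f (\<i> * z)"]) (auto simp: complex_eq_iff)
    also have "\<dots> = (\<integral>\<^sup>+z. f z \<partial>lborel)"
      by (rule *) (auto simp: complex_eq_iff)
    finally show ?thesis .
  qed (use * c in auto)
qed

text \<open>The integrand is a product of two one-dimensional Gaussians, each a multiple of a normal
  density.\<close>

lemma nn_integral_gaussian_finite:
  assumes "c > 0"
  shows "(\<integral>\<^sup>+z. ennreal (exp (- c * (cmod z)\<^sup>2)) \<partial>lborel) < \<infinity>"
proof -
  define s where "s = sqrt (1 / (2 * c))"
  have s: "s > 0" "2 * s\<^sup>2 = 1 / c"
    using assms by (auto simp: s_def field_simps)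
  let ?I = "\<integral>\<^sup>+x. ennreal (exp (- c * x\<^sup>2)) \<partial>lborel"
  have "integrable lborel (\<lambda>x. sqrt (2 * pi * s\<^sup>2) * normal_density 0 s x)"
    using s by (intro integrable_mult_right) auto
  moreover have "sqrt (2 * pi * s\<^sup>2) * normal_density 0 s x = exp (- c * x\<^sup>2)" for x
    using s assms by (simp add: normal_density_def real_sqrt_mult)
  ultimately have int: "integrable lborel (\<lambda>x::real. exp (- c * x\<^sup>2))" by simp
  then have "?I < \<infinity>"
    by (subst nn_integral_eq_integral) auto
  have "exp (- c * (cmod (Complex x y))\<^sup>2) = exp (- c * x\<^sup>2) * exp (- c * y\<^sup>2)" for x y
    by (simp add: cmod_def algebra_simps flip: exp_add)
  then have "(\<integral>\<^sup>+z. ennreal (exp (- c * (cmod z)\<^sup>2)) \<partial>lborel)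
      = (\<integral>\<^sup>+x. \<integral>\<^sup>+y. ennreal (exp (- c * x\<^sup>2)) * ennreal (exp (- c * y\<^sup>2)) \<partial>lborel \<partial>lborel)"
    by (simp add: nn_integral_lborel_complex ennreal_mult)
  also have "\<dots> = ?I * ?I"
    by (simp add: nn_integral_cmult nn_integral_multc)
  also have "\<dots> < \<infinity>"
    using \<open>?I < \<infinity>\<close> by (simp add: ennreal_mult_less_top)
  finally show ?thesis .
qed

lemma nn_integral_pos_lborel:
  fixes f :: "complex \<Rightarrow> real"
  assumes [measurable]: "f \<in> borel_measurable borel" and pos: "\<And>z. f z > 0"
  shows "(\<integral>\<^sup>+z. ennreal (f z) \<partial>lborel) > 0"
proof -
  have "ennreal (f z) \<noteq> 0" for z
    using pos[of z] by simp
  then have "(\<integral>\<^sup>+z. ennreal (f z) \<partial>lborel) \<noteq> 0"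
    by (subst nn_integral_0_iff) auto
  then show ?thesis by (simp add: zero_less_iff_neq_zero)
qed

section \<open>Weighted norms and pointwise bounds\<close>

text \<open>The Gaussian factor is moved into the argument \<open>h\<close>. What remains is an L^p
  norm for plain Lebesgue measure, to which comparison and invariance under isometries of the plane
  apply.\<close>

definition weighted_norm :: "ennreal \<Rightarrow> (complex \<Rightarrow> real) \<Rightarrow> ennreal" where
  "weighted_norm p h =
     (if p = \<infinity> then (SUP z. ennreal (h z))
      else let q = enn2real p;
               I = ennreal (q / (2 * pi)) * (\<integral>\<^sup>+ z. ennreal (h z powr q) \<partial>lborel)
           in if I = \<infinity> then \<infinity> else ennreal (enn2real I powr (1/q)))"

definition gweight :: "(complex \<Rightarrow> complex) \<Rightarrow> complex \<Rightarrow> real" where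
  "gweight f z = cmod (f z) * exp (- (1/2) * (cmod z)\<^sup>2)"

lemma gweight_nonneg [simp]: "0 \<le> gweight f z"
  by (simp add: gweight_def)

lemma fock_norm_eq_weighted_norm: "fock_norm p f = weighted_norm p (gweight f)"
proof -
  have "gweight f z powr q = cmod (f z) powr q * exp (- (q/2) * (cmod z)\<^sup>2)" for z q
    by (simp add: gweight_def powr_mult exp_powr_real)
  then show ?thesis
    unfolding fock_norm_def weighted_norm_def gweight_def[symmetric] by simp
qed

lemma ennreal_exponent_cases:
  assumes "1 \<le> p"
  obtains "p = \<infinity>" | q where "q \<ge> 1" "p = ennreal q"
  using assms by (cases p rule: ennreal_cases) auto

lemma weighted_norm_ennreal:
  assumes "q \<ge> 1"
  shows "weighted_norm (ennreal q) h =
    (let I = ennreal (q / (2 * pi)) * (\<integral>\<^sup>+ z. ennreal (h z powr q) \<partial>lborel)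
     in if I = \<infinity> then \<infinity> else ennreal (enn2real I powr (1/q)))"
  using assms by (simp add: weighted_norm_def)

lemma weighted_norm_finite_iff:
  assumes "q \<ge> 1"
  shows "weighted_norm (ennreal q) h < top \<longleftrightarrow> (\<integral>\<^sup>+ z. ennreal (h z powr q) \<partial>lborel) < top"
  using assms by (auto simp: weighted_norm_ennreal Let_def ennreal_mult_eq_top_iff less_top)

lemma nn_integral_le_weighted_norm:
  assumes q: "q \<ge> 1" and M: "M \<ge> 0" "weighted_norm (ennreal q) h \<le> ennreal M"
  shows "(\<integral>\<^sup>+ z. ennreal (h z powr q) \<partial>lborel) \<le> ennreal (2 * pi / q * M powr q)"
proof -
  define J where "J = (\<integral>\<^sup>+ z. ennreal (h z powr q) \<partial>lborel)"
  have "weighted_norm (ennreal q) h < top"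
    using M(2) by (simp add: le_less_trans)
  then have "J < top"
    using q by (simp add: weighted_norm_finite_iff J_def)
  then obtain j where j: "j \<ge> 0" "J = ennreal j"
    by (cases J) auto
  have "ennreal (q / (2 * pi)) * J = ennreal (q / (2 * pi) * j)"
    using q j by (simp flip: ennreal_mult)
  then have "weighted_norm (ennreal q) h = ennreal ((q / (2 * pi) * j) powr (1/q))"
    using q j by (simp add: weighted_norm_ennreal Let_def J_def[symmetric])
  with M have "(q / (2 * pi) * j) powr (1/q) \<le> M"
    by (simp del: ennreal_le_iff add: ennreal_le_iff[OF M(1)])
  then have "((q / (2 * pi) * j) powr (1/q)) powr q \<le> M powr q"
    using q by (intro powr_mono2) auto
  then have "q / (2 * pi) * j \<le> M powr q"
    using q j by (simp add: powr_powr)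
  then have "j \<le> 2 * pi / q * M powr q"
    using q by (simp add: field_simps)
  then show ?thesis
    unfolding J_def[symmetric] j(2) by (rule ennreal_leI)
qed

text \<open>The comparison that puts functions into a Fock space: against a Gaussian in
  \<open>fock_space_if_gaussian_bound\<close>, against a weight moved by an isometry in
  \<open>surjective_if_unimodular\<close>.\<close>

lemma weighted_norm_finite_mono:
  assumes p: "1 \<le> p" and h: "\<And>z. 0 \<le> h z" "\<And>z. h z \<le> c * k z" and c: "c \<ge> 0"
    and k: "\<And>z. 0 \<le> k z" "k \<in> borel_measurable borel" "weighted_norm p k < top"
  shows "weighted_norm p h < top"
  using p
proof (cases rule: ennreal_exponent_cases)
  case 1
  have "(SUP z. ennreal (h z)) \<le> ennreal c * (SUP z. ennreal (k z))"
  proof (rule SUP_least)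
    fix z
    have "ennreal (h z) \<le> ennreal c * ennreal (k z)"
      using h(2)[of z] c k(1) by (simp add: ennreal_leI flip: ennreal_mult)
    also have "\<dots> \<le> ennreal c * (SUP z. ennreal (k z))"
      by (intro mult_left_mono SUP_upper) auto
    finally show "ennreal (h z) \<le> ennreal c * (SUP z. ennreal (k z))" .
  qed
  also have "\<dots> < top"
    using k(3) 1 by (simp add: weighted_norm_def ennreal_mult_less_top)
  finally show ?thesis using 1 by (simp add: weighted_norm_def)
next
  case (2 q)
  note [measurable] = k(2)
  have "(\<integral>\<^sup>+ z. ennreal (h z powr q) \<partial>lborel) \<le> (\<integral>\<^sup>+ z. ennreal (c powr q) * ennreal (k z powr q) \<partial>lborel)"
  proof (rule nn_integral_mono)
    fix z
    have "h z powr q \<le> (c * k z) powr q"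
      using h 2 by (intro powr_mono2) auto
    then show "ennreal (h z powr q) \<le> ennreal (c powr q) * ennreal (k z powr q)"
      using c k(1) by (simp add: powr_mult ennreal_leI flip: ennreal_mult)
  qed
  also have "\<dots> = ennreal (c powr q) * (\<integral>\<^sup>+ z. ennreal (k z powr q) \<partial>lborel)"
    by (rule nn_integral_cmult) measurable
  also have "\<dots> < top"
    using k(3) 2 by (simp add: weighted_norm_finite_iff ennreal_mult_less_top)
  finally show ?thesis
    using 2 by (simp add: weighted_norm_finite_iff)
qed

text \<open>For the supremum it matters only that the affine map is onto; for finite exponents the
  integral is invariant under the rotation and under the translation.\<close>

lemma weighted_norm_isometry:
  assumes p: "1 \<le> p" and [measurable]: "h \<in> borel_measurable borel" and a: "cmod a = 1"
  shows "weighted_norm p (\<lambda>z. h (a * z + b)) = weighted_norm p h"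
  using p
proof (cases rule: ennreal_exponent_cases)
  case 1
  have "a \<noteq> 0" using a by auto
  then have "range (\<lambda>z. a * z + b) = UNIV"
    by (intro surjI[of _ "\<lambda>w. (w - b) / a"]) simp
  moreover have "(SUP z. ennreal (h (a * z + b))) = (SUP w\<in>range (\<lambda>z. a * z + b). ennreal (h w))"
    by (simp add: image_image)
  ultimately show ?thesis
    using 1 by (simp add: weighted_norm_def)
next
  case (2 q)
  have "(\<integral>\<^sup>+ z. ennreal (h (a * z + b) powr q) \<partial>lborel) = (\<integral>\<^sup>+ z. ennreal (h (z + b) powr q) \<partial>lborel)"
    using nn_integral_rotate[of "\<lambda>z. ennreal (h (z + b) powr q)" a] a by simp
  also have "\<dots> = (\<integral>\<^sup>+ z. ennreal (h z powr q) \<partial>lborel)"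
    using nn_integral_lborel_translate[of "\<lambda>z. ennreal (h z powr q)" b] by (simp add: add.commute)
  finally show ?thesis
    using 2 by (simp add: weighted_norm_ennreal)
qed

lemma weighted_norm_gaussian_finite:
  assumes "1 \<le> p" "c > 0"
  shows "weighted_norm p (\<lambda>z. exp (- c * (cmod z)\<^sup>2)) < top"
  using assms(1)
proof (cases rule: ennreal_exponent_cases)
  case 1
  have "(SUP z. ennreal (exp (- c * (cmod z)\<^sup>2))) \<le> ennreal 1"
    using assms by (intro SUP_least ennreal_leI) simp
  also have "\<dots> < top" by simp
  finally show ?thesis using 1 by (simp add: weighted_norm_def)
next
  case (2 q)
  then show ?thesis
    using nn_integral_gaussian_finite[of "c * q"] assms
    by (simp add: weighted_norm_finite_iff exp_powr_real mult_ac)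
qed

section \<open>Mean values on circles and the pointwise bound\<close>

text \<open>Cauchy's formula on the unit circle for the dilated function
  \<open>g w = f (w * z)\<close>. Keeping \<open>z\<close> as a parameter allows a later integration
  over the plane without polar coordinates.\<close>

lemma norm_le_nn_integral_circle:
  assumes f: "f holomorphic_on UNIV"
  shows "ennreal (cmod (f 0)) \<le> (\<integral>\<^sup>+t. ennreal (cmod (f (cis (2 * pi * t) * z))) * indicator {0..1} t \<partial>lborel)"
proof -
  define g where "g w = f (w * z)" for w
  have g: "g holomorphic_on UNIV"
    unfolding g_def by (intro holomorphic_on_compose_gen[OF _ f, unfolded o_def] holomorphic_intros) auto
  have cg: "continuous_on A g" for A
    using g by (meson holomorphic_on_imp_continuous_on holomorphic_on_subset subset_UNIV)
  have "((\<lambda>u. g u / (u - 0)) has_contour_integral (2 * of_real pi * \<i> * g 0)) (circlepath 0 1)"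
    by (rule Cauchy_integral_circlepath_simple) (auto intro: holomorphic_on_subset[OF g])
  then have "((\<lambda>t. g (cis (2 * pi * t)) * (2 * of_real pi * \<i>)) has_integral (2 * of_real pi * \<i> * g 0)) {0..1}"
    unfolding has_contour_integral
    by (rule has_integral_eq[rotated], unfold vector_derivative_circlepath)
      (auto simp: circlepath cis_conv_exp mult_ac)
  then have "((\<lambda>t. (g (cis (2 * pi * t)) * (2 * of_real pi * \<i>)) * (1 / (2 * of_real pi * \<i>))) has_integral
       (2 * of_real pi * \<i> * g 0) * (1 / (2 * of_real pi * \<i>))) {0..1}"
    by (rule has_integral_mult_left)
  then have int: "((\<lambda>t. g (cis (2 * pi * t))) has_integral g 0) {0..1}"
    by simp
  have cont: "continuous_on A (\<lambda>t. cmod (g (cis (2 * pi * t))))" for A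
    unfolding cis_conv_exp
    by (intro continuous_intros continuous_on_compose2[OF cg[of UNIV]]) auto
  then have int': "((\<lambda>t. cmod (g (cis (2 * pi * t)))) has_integral integral {0..1} (\<lambda>t. cmod (g (cis (2 * pi * t))))) {0..1}"
    by (intro integrable_integral integrable_continuous_real)
  have "cmod (g 0) = cmod (integral {0..1} (\<lambda>t. g (cis (2 * pi * t))))"
    using int by (simp add: integral_unique)
  also have "\<dots> \<le> integral {0..1} (\<lambda>t. cmod (g (cis (2 * pi * t))))"
    using int int' by (intro integral_norm_bound_integral) (auto simp: has_integral_iff)
  finally have le: "cmod (g 0) \<le> integral {0..1} (\<lambda>t. cmod (g (cis (2 * pi * t))))" .
  have [measurable]: "(\<lambda>t. cmod (g (cis (2 * pi * t)))) \<in> borel_measurable borel"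
    by (intro borel_measurable_continuous_onI cont)
  have "((\<lambda>t. cmod (g (cis (2 * pi * t))) * indicator {0..1} t) has_integral
      integral {0..1} (\<lambda>t. cmod (g (cis (2 * pi * t))))) UNIV"
    using int' by (subst (asm) has_integral_restrict_UNIV[symmetric])
      (simp add: indicator_def of_bool_def if_distrib cong: if_cong)
  then have "(\<integral>\<^sup>+t. ennreal (cmod (g (cis (2 * pi * t))) * indicator {0..1} t) \<partial>lborel)
      = ennreal (integral {0..1} (\<lambda>t. cmod (g (cis (2 * pi * t)))))"
    by (intro nn_integral_has_integral_lborel) auto
  moreover have "ennreal (x * indicator {0..1} t) = ennreal x * indicator {0..1} t" for x t :: real
    by (simp add: indicator_def)
  ultimately show ?thesis
    using le by (simp add: g_def ennreal_leI)
qed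

text \<open>A substitute for Jensen's inequality with a worse constant: \<open>x \<le> A/2\<close>, or
  \<open>x\<close> is controlled by \<open>x powr q\<close>.\<close>

lemma powr_le_nn_integral_circle:
  assumes f: "f holomorphic_on UNIV" and q: "q \<ge> 1"
  shows "ennreal ((cmod (f 0) / 2) powr q)
    \<le> (\<integral>\<^sup>+t. ennreal (cmod (f (cis (2 * pi * t) * z)) powr q) * indicator {0..1} t \<partial>lborel)"
    (is "_ \<le> ?J")
proof (cases "f 0 = 0 \<or> ?J = \<infinity>")
  case False
  define A where "A = cmod (f 0)"
  define K where "K = (A / 2) powr (1 - q)"
  have A: "A > 0" and K: "K > 0" using False by (auto simp: A_def K_def)
  obtain j where j: "j \<ge> 0" "?J = ennreal j"
    using False by (cases ?J) auto
  have cf: "continuous_on UNIV f"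
    using f by (rule holomorphic_on_imp_continuous_on)
  have "continuous_on UNIV (\<lambda>t. cmod (f (cis (2 * pi * t) * z)))"
    unfolding cis_conv_exp by (intro continuous_intros continuous_on_compose2[OF cf]) auto
  then have [measurable]: "(\<lambda>t. cmod (f (cis (2 * pi * t) * z))) \<in> borel_measurable borel"
    by (rule borel_measurable_continuous_onI)
  have bound: "x \<le> A / 2 + K * x powr q" if "x \<ge> 0" for x
  proof (cases "x \<le> A / 2")
    case False
    \<comment> \<open>The exponent \<open>1 - q\<close> is not positive, so this power decreases in
      \<open>x\<close> and is at most its value at \<open>A / 2\<close>.\<close>
    then have "x powr (1 - q) \<le> K"
      unfolding K_def using A q by (intro powr_mono2') auto
    then have "x powr (1 - q) * x powr q \<le> K * x powr q"
      by (intro mult_right_mono) auto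
    then show ?thesis
      using False A by (simp flip: powr_add)
  qed (use K in \<open>simp add: add_increasing2\<close>)
  have "ennreal A \<le> (\<integral>\<^sup>+t. ennreal (cmod (f (cis (2 * pi * t) * z))) * indicator {0..1} t \<partial>lborel)"
    unfolding A_def by (rule norm_le_nn_integral_circle[OF f])
  also have "\<dots> \<le> (\<integral>\<^sup>+t. ennreal (A / 2) * indicator {0..1} t
      + ennreal K * (ennreal (cmod (f (cis (2 * pi * t) * z)) powr q) * indicator {0..1} t) \<partial>lborel)"
    using A K bound
    by (intro nn_integral_mono) (auto simp: indicator_def ennreal_leI simp flip: ennreal_mult ennreal_plus)
  also have "\<dots> = ennreal (A / 2) + ennreal K * ?J"
    by (subst nn_integral_add) (auto simp: nn_integral_cmult)
  also have "\<dots> = ennreal (A / 2 + K * j)"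
    using A K j by (simp add: ennreal_mult)
  \<comment> \<open>Half of \<open>A\<close> is absorbed on the left, which leaves
    \<open>A / 2 \<le> K * j\<close>.\<close>
  finally have "A \<le> A / 2 + K * j"
    using A K j by (subst (asm) ennreal_le_iff) auto
  then have "A / 2 / K \<le> j"
    using K by (simp add: field_simps)
  moreover have "A / 2 / K = (A / 2) powr q"
    using A by (simp add: K_def powr_diff)
  ultimately show ?thesis
    by (simp add: j A_def ennreal_leI)
qed (use q in auto)

text \<open>The circle estimate is multiplied by the radial Gaussian and integrated over
  \<open>z\<close>. After exchanging the integrals, rotation invariance makes the inner one
  independent of \<open>t\<close>.\<close>

lemma gaussian_mean_le:
  assumes f: "f holomorphic_on UNIV" and q: "q \<ge> 1"
  shows "ennreal ((cmod (f 0) / 2) powr q) * (\<integral>\<^sup>+z. ennreal (exp (- (q/2) * (cmod z)\<^sup>2)) \<partial>lborel)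
    \<le> (\<integral>\<^sup>+z. ennreal (gweight f z powr q) \<partial>lborel)"
proof -
  have [measurable]: "f \<in> borel_measurable borel"
    using f by (intro borel_measurable_continuous_onI holomorphic_on_imp_continuous_on)
  have [measurable]: "(\<lambda>t. cis (2 * pi * t)) \<in> borel_measurable borel"
    unfolding cis_conv_exp by (intro borel_measurable_continuous_onI continuous_intros)
  have [measurable]: "gweight f \<in> borel_measurable borel"
    unfolding gweight_def by measurable
  define A where "A = (cmod (f 0) / 2) powr q"
  have gw: "ennreal (exp (- (q/2) * (cmod z)\<^sup>2)) * ennreal (cmod (f (cis (2 * pi * t) * z)) powr q)
      = ennreal (gweight f (cis (2 * pi * t) * z) powr q)" for z t
    by (simp add: gweight_def powr_mult exp_powr_real norm_mult mult.commute flip: ennreal_mult)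
  have "ennreal A * (\<integral>\<^sup>+z. ennreal (exp (- (q/2) * (cmod z)\<^sup>2)) \<partial>lborel)
      = (\<integral>\<^sup>+z. ennreal (exp (- (q/2) * (cmod z)\<^sup>2)) * ennreal A \<partial>lborel)"
    by (subst nn_integral_multc) (auto simp: mult.commute)
  also have "\<dots> \<le> (\<integral>\<^sup>+z. ennreal (exp (- (q/2) * (cmod z)\<^sup>2)) *
      (\<integral>\<^sup>+t. ennreal (cmod (f (cis (2 * pi * t) * z)) powr q) * indicator {0..1} t \<partial>lborel) \<partial>lborel)"
    unfolding A_def by (intro nn_integral_mono mult_left_mono powr_le_nn_integral_circle f q) auto
  also have "\<dots> = (\<integral>\<^sup>+z. \<integral>\<^sup>+t. ennreal (gweight f (cis (2 * pi * t) * z) powr q) * indicator {0..1} t \<partial>lborel \<partial>lborel)"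
    by (subst nn_integral_cmult[symmetric]) (simp_all flip: gw mult.assoc)
  also have "\<dots> = (\<integral>\<^sup>+t. \<integral>\<^sup>+z. ennreal (gweight f (cis (2 * pi * t) * z) powr q) * indicator {0..1} t \<partial>lborel \<partial>lborel)"
    by (rule lborel_pair.Fubini') measurable
  also have "\<dots> = (\<integral>\<^sup>+t. (\<integral>\<^sup>+z. ennreal (gweight f z powr q) \<partial>lborel) * indicator {0..1::real} t \<partial>lborel)"
    using nn_integral_rotate[of "\<lambda>z. ennreal (gweight f z powr q)"]
    by (simp add: nn_integral_multc)
  also have "\<dots> = (\<integral>\<^sup>+z. ennreal (gweight f z powr q) \<partial>lborel)"
    by (simp add: nn_integral_cmult)
  finally show ?thesis unfolding A_def .
qed

lemma gweight_measurable:
  assumes "f holomorphic_on UNIV"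
  shows "gweight f \<in> borel_measurable borel"
proof -
  have [measurable]: "f \<in> borel_measurable borel"
    using assms by (intro borel_measurable_continuous_onI holomorphic_on_imp_continuous_on)
  show ?thesis unfolding gweight_def by measurable
qed

text \<open>The Weyl operators \<open>f \<mapsto> f (w + z) exp (- cnj w z - |w|^2/2)\<close> are isometries of the Fock spaces,
  which reduces the pointwise bound to the origin.\<close>

lemma gweight_Weyl:
  "gweight (\<lambda>z. f (w + z) * exp (- cnj w * z - of_real ((cmod w)\<^sup>2 / 2))) z = gweight f (w + z)"
proof -
  have "(cmod (w + z))\<^sup>2 = (cmod w)\<^sup>2 + 2 * Re (cnj w * z) + (cmod z)\<^sup>2"
    unfolding cmod_power2 by (simp add: algebra_simps power2_eq_square)
  then show ?thesis
    by (simp add: gweight_def norm_mult norm_exp_eq_Re field_simps flip: exp_add)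
qed

text \<open>Point evaluations are bounded, uniformly in the point. For finite exponents a Weyl
  operator moves the point to the origin, where \<open>gaussian_mean_le\<close> applies;
  \<open>K\<close> is fixed before \<open>f\<close> and the point.\<close>

lemma gweight_le_fock_norm:
  assumes p: "1 \<le> p"
  shows "\<exists>K. \<forall>f M z. f holomorphic_on UNIV \<longrightarrow> M \<ge> 0 \<longrightarrow> fock_norm p f \<le> ennreal M \<longrightarrow> gweight f z \<le> K * M"
  using p
proof (cases rule: ennreal_exponent_cases)
  case 1
  have "gweight f z \<le> 1 * M" if "M \<ge> 0" "fock_norm p f \<le> ennreal M" for f M z
  proof -
    have "ennreal (gweight f z) \<le> fock_norm p f"
      unfolding fock_norm_eq_weighted_norm weighted_norm_def using 1 by (auto intro: SUP_upper)
    with that have "ennreal (gweight f z) \<le> ennreal M" by order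
    with that show ?thesis by simp
  qed
  then show ?thesis by blast
next
  case (2 q)
  define I where "I = (\<integral>\<^sup>+z. ennreal (exp (- (q/2) * (cmod z)\<^sup>2)) \<partial>lborel)"
  have "I < top"
    unfolding I_def using nn_integral_gaussian_finite[of "q/2"] 2 by simp
  moreover have "I > 0"
    unfolding I_def by (intro nn_integral_pos_lborel) auto
  ultimately obtain G where G: "G > 0" "I = ennreal G"
    by (cases I) auto
  \<comment> \<open>Obtained by solving
    \<open>(cmod (F 0) / 2) powr q * G \<le> 2 * pi / q * M powr q\<close> for
    \<open>cmod (F 0)\<close>.\<close>
  define K where "K = 2 * (2 * pi / q / G) powr (1 / q)"
  have "gweight f w \<le> K * M"
    if f: "f holomorphic_on UNIV" and M: "M \<ge> 0" "fock_norm p f \<le> ennreal M" for f M w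
  proof -
    define F where "F z = f (w + z) * exp (- cnj w * z - of_real ((cmod w)\<^sup>2 / 2))" for z
    have F: "F holomorphic_on UNIV"
      unfolding F_def by (intro holomorphic_intros holomorphic_on_compose_gen[OF _ f, unfolded o_def]) auto
    \<comment> \<open>The factor 1 gives the shape required by
      \<open>weighted_norm_isometry\<close>.\<close>
    have gF: "gweight F z = gweight f (1 * z + w)" for z
      unfolding F_def gweight_Weyl by (simp add: add.commute)
    have "weighted_norm (ennreal q) (gweight F) = weighted_norm p (gweight f)"
      unfolding gF using weighted_norm_isometry[OF p gweight_measurable[OF f], of 1 w] 2 by (simp add: gF cong: if_cong)
    then have "weighted_norm (ennreal q) (gweight F) \<le> ennreal M"
      using M by (simp add: fock_norm_eq_weighted_norm)
    then have "(\<integral>\<^sup>+z. ennreal (gweight F z powr q) \<partial>lborel) \<le> ennreal (2 * pi / q * M powr q)"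
      using 2 M by (intro nn_integral_le_weighted_norm) auto
    with gaussian_mean_le[OF F 2(1)] have "ennreal ((cmod (F 0) / 2) powr q) * ennreal G \<le> ennreal (2 * pi / q * M powr q)"
      unfolding I_def[symmetric] G(2) by order
    then have "(cmod (F 0) / 2) powr q * G \<le> 2 * pi / q * M powr q"
      using 2 G by (simp flip: ennreal_mult)
    then have "(cmod (F 0) / 2) powr q \<le> 2 * pi / q / G * M powr q"
      using 2 G by (simp add: field_simps)
    then have "((cmod (F 0) / 2) powr q) powr (1/q) \<le> (2 * pi / q / G * M powr q) powr (1/q)"
      using 2 by (intro powr_mono2) auto
    also have "\<dots> = (2 * pi / q / G) powr (1/q) * M"
      using 2 G M by (subst powr_mult) (auto simp: powr_powr)
    finally have "cmod (F 0) \<le> K * M"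
      using 2 by (simp add: powr_powr K_def)
    moreover have "cmod (F 0) = gweight f w"
      using gF[of 0] by (simp add: gweight_def)
    ultimately show ?thesis by simp
  qed
  then show ?thesis by blast
qed

lemma fock_norm_finite_gweight_le:
  assumes "1 \<le> p" "f \<in> fock_space p"
  obtains B where "\<And>z. gweight f z \<le> B"
proof -
  have f: "f holomorphic_on UNIV" "fock_norm p f < top"
    using assms by (auto simp: fock_space_def)
  then obtain M where "M \<ge> 0" "fock_norm p f = ennreal M"
    by (cases "fock_norm p f") auto
  with f show ?thesis
    using gweight_le_fock_norm[OF assms(1)] that by (metis order_refl)
qed

section \<open>Normalised kernels and functions of small Gaussian growth\<close>

text \<open>Completing the square: the weighted modulus of the normalised kernel at \<open>w\<close>
  is the Gaussian centred at \<open>w\<close>. Hence all these kernels have the same norm.\<close>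

lemma gweight_coherent:
  "gweight (\<lambda>z. exp (cnj w * z - of_real ((cmod w)\<^sup>2 / 2))) z = exp (- (1/2) * (cmod (1 * z + (- w)))\<^sup>2)"
proof -
  have "(cmod (z - w))\<^sup>2 = (cmod w)\<^sup>2 - 2 * Re (cnj w * z) + (cmod z)\<^sup>2"
    unfolding cmod_power2 by (simp add: algebra_simps power2_eq_square)
  then show ?thesis
    by (simp add: gweight_def norm_exp_eq_Re field_simps flip: exp_add)
qed

lemma fock_norm_coherent:
  assumes p: "1 \<le> p"
  shows "fock_norm p (\<lambda>z. exp (cnj w * z - of_real ((cmod w)\<^sup>2 / 2)))
    = weighted_norm p (\<lambda>z. exp (- (1/2) * (cmod z)\<^sup>2))"
proof -
  have "(\<lambda>z. exp (- (1/2) * (cmod z)\<^sup>2)) \<in> borel_measurable borel"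
    by measurable
  from weighted_norm_isometry[OF p this, of 1 "- w"]
  show ?thesis
    unfolding fock_norm_eq_weighted_norm gweight_coherent[abs_def] by simp
qed

lemma fock_space_coherent:
  assumes p: "1 \<le> p"
  shows "(\<lambda>z. exp (cnj w * z - of_real ((cmod w)\<^sup>2 / 2))) \<in> fock_space p"
  using fock_norm_coherent[OF p, of w] weighted_norm_gaussian_finite[OF p, of "1/2"]
  by (auto simp: fock_space_def intro!: holomorphic_intros)

text \<open>The weight leaves the decay \<open>exp (- ((1 - c) / 2) * (cmod z)\<^sup>2)\<close>,
  whose norm is finite for every exponent.\<close>

lemma fock_space_if_gaussian_bound:
  assumes p: "1 \<le> p" and f: "f holomorphic_on UNIV" and c: "c < 1"
    and le: "\<And>z. cmod (f z) \<le> exp (c / 2 * (cmod z)\<^sup>2)"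
  shows "f \<in> fock_space p"
proof -
  have "weighted_norm p (gweight f) < top"
  proof (rule weighted_norm_finite_mono[OF p])
    show "gweight f z \<le> 1 * exp (- ((1 - c) / 2) * (cmod z)\<^sup>2)" for z
    proof -
      have "gweight f z \<le> exp (c / 2 * (cmod z)\<^sup>2) * exp (- (1/2) * (cmod z)\<^sup>2)"
        unfolding gweight_def by (intro mult_right_mono le) auto
      also have "\<dots> = exp (- ((1 - c) / 2) * (cmod z)\<^sup>2)"
        by (simp add: field_simps flip: exp_add)
      finally show ?thesis by simp
    qed
    show "weighted_norm p (\<lambda>z. exp (- ((1 - c) / 2) * (cmod z)\<^sup>2)) < top"
      using c by (intro weighted_norm_gaussian_finite p) auto
  qed auto
  then show ?thesis
    using f by (simp add: fock_space_def fock_norm_eq_weighted_norm)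
qed

section \<open>Entire functions and Gaussian growth\<close>

text \<open>The difference of the two exponents is a quadratic polynomial in \<open>r\<close> with
  positive leading coefficient \<open>(c - \<alpha>\<^sup>2) / 2\<close>, so it exceeds the
  logarithm of any positive constant.\<close>

lemma eventually_gaussian_dominates:
  fixes \<alpha> \<beta> c D :: real
  assumes "\<alpha>\<^sup>2 < c"
  shows "\<forall>\<^sub>F r in at_top. D * exp (1/2 * (\<alpha> * r + \<beta>)\<^sup>2) < exp (c/2 * r\<^sup>2)"
proof -
  define e where "e = (c - \<alpha>\<^sup>2) / 2"
  have e: "e > 0" using assms by (simp add: e_def)
  define b where "b = \<alpha> * \<beta>"
  have "filterlim (\<lambda>r. e * r\<^sup>2 - b * r - \<beta>\<^sup>2 / 2) at_top at_top"
    using e by real_asymp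
  then have "filterlim (\<lambda>r. exp (e * r\<^sup>2 - b * r - \<beta>\<^sup>2 / 2)) at_top at_top"
    by (rule filterlim_compose[OF exp_at_top])
  then have "\<forall>\<^sub>F r in at_top. D < exp (e * r\<^sup>2 - b * r - \<beta>\<^sup>2 / 2)"
    by (simp add: filterlim_at_top_dense)
  then show ?thesis
  proof eventually_elim
    case (elim r)
    then have "D * exp (1/2 * (\<alpha> * r + \<beta>)\<^sup>2) < exp (e * r\<^sup>2 - b * r - \<beta>\<^sup>2 / 2) * exp (1/2 * (\<alpha> * r + \<beta>)\<^sup>2)"
      by simp
    also have "\<dots> = exp (c/2 * r\<^sup>2)"
      by (simp add: e_def b_def power2_eq_square field_simps flip: exp_add)
    finally show ?case .
  qed
qed

lemma higher_deriv_exp_affine: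
  fixes c d :: complex
  shows "(deriv ^^ n) (\<lambda>z. exp (c * z - d)) = (\<lambda>z. c ^ n * exp (c * z - d))"
proof (induction n)
  case (Suc n)
  have "deriv (\<lambda>z. c ^ n * exp (c * z - d)) z = c ^ Suc n * exp (c * z - d)" for z
    by (rule DERIV_imp_deriv) (auto intro!: derivative_eq_intros)
  then show ?case by (simp add: Suc.IH)
qed simp

section \<open>Taylor coefficients and the affine form of \<open>\<psi>\<close>\<close>

lemma entire_compose_affine:
  fixes f :: "complex \<Rightarrow> complex"
  assumes "f holomorphic_on UNIV"
  shows "(\<lambda>z. f (a * z + b)) holomorphic_on A"
  by (intro holomorphic_on_compose_gen[OF _ assms, unfolded o_def] holomorphic_intros) auto

lemma entire_sums_Taylor:
  fixes f :: "complex \<Rightarrow> complex"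
  assumes "f holomorphic_on UNIV"
  shows "(\<lambda>j. (deriv ^^ j) f 0 / fact j * z ^ j) sums f z"
  using holomorphic_power_series[of f 0 "cmod z + 1" z] holomorphic_on_subset[OF assms] by simp

text \<open>The tail of the Taylor series divided by \<open>z ^ k\<close> is again a power series
  converging everywhere, hence entire.\<close>

lemma entire_Taylor_remainder:
  fixes f :: "complex \<Rightarrow> complex"
  assumes f: "f holomorphic_on UNIV"
  defines "a \<equiv> \<lambda>j. (deriv ^^ j) f 0 / fact j"
  obtains S where "S holomorphic_on UNIV" "S 0 = a k" "\<And>z. f z = (\<Sum>j<k. a j * z ^ j) + z ^ k * S z"
proof -
  define S where "S z = (\<Sum>j. a (j + k) * z ^ j)" for z
  have sums: "(\<lambda>j. a j * z ^ j) sums f z" for z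
    unfolding a_def by (rule entire_sums_Taylor[OF f])
  have summ: "summable (\<lambda>j. a (j + k) * z ^ j)" for z
  proof (cases "z = 0")
    case False
    have "summable (\<lambda>j. a (j + k) * z ^ (j + k))"
      using sums_summable[OF sums[of z]] by (rule summable_ignore_initial_segment)
    then have "summable (\<lambda>j. a (j + k) * z ^ (j + k) / z ^ k)"
      by (rule summable_divide)
    with False show ?thesis by (simp add: power_add)
  qed (simp add: summable_0_powser)
  then have Ss: "(\<lambda>j. a (j + k) * z ^ j) sums S z" for z
    unfolding S_def by (rule summable_sums)
  show ?thesis
  proof
    have "S holomorphic_on ball 0 r" for r
      using Ss by (intro power_series_holomorphic[where a = "\<lambda>j. a (j + k)"]) simp
    moreover have "\<exists>r. z \<in> ball 0 r" for z :: complex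
      by (rule exI[of _ "cmod z + 1"]) simp
    ultimately show "S holomorphic_on UNIV"
      by (metis holomorphic_on_imp_differentiable_at field_differentiable_at_within holomorphic_on_def open_ball)
    show "S 0 = a k"
      by (simp add: S_def)
    show "f z = (\<Sum>j<k. a j * z ^ j) + z ^ k * S z" for z
    proof -
      have "(\<lambda>j. z ^ k * (a (j + k) * z ^ j)) sums (z ^ k * S z)"
        by (rule sums_mult[OF Ss])
      then have "(\<lambda>j. a (j + k) * z ^ (j + k)) sums (z ^ k * S z)"
        by (simp add: power_add mult_ac)
      then have "(\<lambda>j. a j * z ^ j) sums (z ^ k * S z + (\<Sum>j<k. a j * z ^ j))"
        using sums_iff_shift[of "\<lambda>j. a j * z ^ j" k "z ^ k * S z"] by simp
      then show ?thesis
        using sums_unique2[OF sums] by (simp add: add.commute)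
    qed
  qed
qed

text \<open>On the circle \<open>|z| = r\<close> the choice \<open>w = a z^k\<close>, with \<open>a\<close> the \<open>k\<close>-th Taylor coefficient of \<open>\<psi>\<close>,
  makes \<open>Re (cnj w * \<psi> z)\<close> the boundary value of the real part of an entire function \<open>G\<close>: the
  antiholomorphic terms \<open>cnj z ^ (k - j)\<close> may be conjugated. The maximum principle for \<open>u exp G\<close> then
  replaces Jensen's formula for \<open>log |u|\<close>.\<close>

lemma Taylor_coeff_growth:
  fixes u \<psi> :: "complex \<Rightarrow> complex" and C R r :: real and k :: nat
  assumes u: "u holomorphic_on UNIV" and \<psi>: "\<psi> holomorphic_on UNIV" and r: "r \<ge> 1"
    and bound: "\<And>z w. cmod (u z) * cmod w ^ n * exp (Re (cnj w * \<psi> z))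
        \<le> C * exp (1/2 * (cmod w)\<^sup>2 + 1/2 * (cmod z + R)\<^sup>2)"
  defines "a \<equiv> (deriv ^^ k) \<psi> 0 / fact k"
  shows "cmod (u 0) * cmod a ^ n * exp (1/2 * (cmod a)\<^sup>2 * r ^ (2 * k)) \<le> C * exp (1/2 * (r + R)\<^sup>2)"
\<comment> \<open>This is exactly the case \<open>cmod a ^ n = 0\<close>: the left side vanishes and
  only \<open>C \<ge> 0\<close> is at stake. Otherwise division by \<open>cmod a ^ n\<close> is
  possible.\<close>
proof (cases "a = 0 \<and> n > 0")
  case True
  have "0 \<le> cmod (u 0) * cmod 1 ^ n * exp (Re (cnj 1 * \<psi> 0))" by simp
  also note bound[of 0 1]
  finally have "C \<ge> 0" by (simp add: zero_le_mult_iff)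
  with True show ?thesis by (simp add: zero_power)
next
  case False
  then have apos: "cmod a ^ n > 0" by auto
  define b where "b j = (deriv ^^ j) \<psi> 0 / fact j" for j
  obtain S where S: "S holomorphic_on UNIV" "S 0 = a"
    "\<And>z. \<psi> z = (\<Sum>j<k. b j * z ^ j) + z ^ k * S z"
    using entire_Taylor_remainder[OF \<psi>, of k] unfolding a_def b_def by blast
  \<comment> \<open>The powers of \<open>r\<close> stand for \<open>(z * cnj z) ^ k\<close> and
    \<open>(z * cnj z) ^ j\<close> on the circle; the terms with \<open>j < k\<close> have been
    conjugated to become holomorphic.\<close>
  define G where "G z = cnj a * of_real (r ^ (2 * k)) * S z
      + (\<Sum>j<k. a * cnj (b j) * of_real (r ^ (2 * j)) * z ^ (k - j))" for z
  have G: "G holomorphic_on UNIV"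
    unfolding G_def by (intro holomorphic_intros S)
  define F where "F z = u z * exp (G z)" for z
  have F: "F holomorphic_on UNIV"
    unfolding F_def by (intro holomorphic_intros u G)
  have ReG: "Re (cnj (a * z ^ k) * \<psi> z) = Re (G z)" if z: "cmod z = r" for z
  proof -
    have "z * cnj z = of_real (r\<^sup>2)"
      using complex_norm_square[of z] z by simp
    then have zz: "cnj z ^ j * z ^ j = of_real (r ^ (2 * j))" for j
      unfolding power_mult_distrib[symmetric] mult.commute[of "cnj z"] by (simp add: power_mult)
    have *: "cnj (a * z ^ k) * (b j * z ^ j) = cnj (a * cnj (b j) * of_real (r ^ (2 * j)) * z ^ (k - j))"
      if "j < k" for j
    proof -
      have "cnj (a * z ^ k) * (b j * z ^ j) = cnj a * b j * (cnj z ^ j * z ^ j) * cnj z ^ (k - j)"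
        using that by (simp add: mult_ac flip: power_add)
      then show ?thesis unfolding zz by simp
    qed
    have "Re (cnj (a * z ^ k) * (\<Sum>j<k. b j * z ^ j))
        = Re (\<Sum>j<k. a * cnj (b j) * of_real (r ^ (2 * j)) * z ^ (k - j))"
      unfolding sum_distrib_left Re_sum by (intro sum.cong refl) (simp only: * lessThan_iff cnj.simps(1))
    moreover have "cnj (a * z ^ k) * (z ^ k * S z) = cnj a * of_real (r ^ (2 * k)) * S z"
      unfolding zz[symmetric] by (simp add: mult_ac)
    ultimately show ?thesis
      unfolding S(3)[of z] G_def by (simp only: distrib_left plus_complex.sel add.commute)
  qed
  \<comment> \<open>The growth hypothesis at \<open>w = a * z ^ k\<close>, where
    \<open>cmod w = cmod a * r ^ k\<close>; since \<open>r \<ge> 1\<close>, the factor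
    \<open>cmod w ^ n\<close> may be replaced by the smaller \<open>cmod a ^ n\<close>.\<close>
  define B where "B = C * exp (1/2 * (cmod a)\<^sup>2 * r ^ (2 * k) + 1/2 * (r + R)\<^sup>2) / cmod a ^ n"
  have "cmod (F 0) \<le> B"
  proof (rule maximum_modulus_frontier[of F "cball 0 r"])
    show "F holomorphic_on interior (cball 0 r)"
      using F by (rule holomorphic_on_subset) simp
    show "continuous_on (closure (cball 0 r)) F"
      using F by (meson holomorphic_on_imp_continuous_on holomorphic_on_subset subset_UNIV)
    show "cmod (F z) \<le> B" if "z \<in> frontier (cball 0 r)" for z
    proof -
      have z: "cmod z = r" using that r by (simp add: frontier_cball)
      have "cmod a ^ n \<le> cmod (a * z ^ k) ^ n"
        using z r by (intro power_mono) (auto simp: norm_mult norm_power mult_le_cancel_left1)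
      then have "cmod (F z) * cmod a ^ n \<le> cmod (F z) * cmod (a * z ^ k) ^ n"
        by (intro mult_left_mono) auto
      also have "\<dots> = cmod (u z) * cmod (a * z ^ k) ^ n * exp (Re (cnj (a * z ^ k) * \<psi> z))"
        unfolding ReG[OF z] by (simp add: F_def norm_mult mult_ac)
      also have "\<dots> \<le> C * exp (1/2 * (cmod (a * z ^ k))\<^sup>2 + 1/2 * (cmod z + R)\<^sup>2)"
        by (rule bound)
      also have "\<dots> = C * exp (1/2 * (cmod a)\<^sup>2 * r ^ (2 * k) + 1/2 * (r + R)\<^sup>2)"
        using z by (simp add: norm_mult norm_power power_mult_distrib mult.commute flip: power_mult)
      finally show ?thesis
        using apos by (simp add: B_def field_simps)
    qed
  qed (use r in auto)
  moreover have "Re (G 0) = (cmod a)\<^sup>2 * r ^ (2 * k)"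
  proof -
    have "(\<Sum>j<k. a * cnj (b j) * of_real (r ^ (2 * j)) * 0 ^ (k - j)) = 0"
      by (intro sum.neutral) auto
    then have "G 0 = of_real ((cmod a)\<^sup>2 * r ^ (2 * k))"
      using complex_norm_square[of a] by (simp add: G_def S(2) mult_ac)
    then show ?thesis by simp
  qed
  ultimately have "cmod (u 0) * exp ((cmod a)\<^sup>2 * r ^ (2 * k)) * cmod a ^ n
      \<le> C * exp (1/2 * (cmod a)\<^sup>2 * r ^ (2 * k) + 1/2 * (r + R)\<^sup>2)"
    using apos by (simp add: F_def norm_mult B_def field_simps)
  \<comment> \<open>One half of the exponent cancels against the contribution of
    \<open>(cmod w)\<^sup>2\<close> on the right; the other half is the gain.\<close>
  moreover have "exp ((cmod a)\<^sup>2 * r ^ (2 * k)) = exp (1/2 * (cmod a)\<^sup>2 * r ^ (2 * k)) * exp (1/2 * (cmod a)\<^sup>2 * r ^ (2 * k))"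
    by (simp flip: exp_add)
  ultimately have "exp (1/2 * (cmod a)\<^sup>2 * r ^ (2 * k)) * (cmod (u 0) * cmod a ^ n * exp (1/2 * (cmod a)\<^sup>2 * r ^ (2 * k)))
      \<le> exp (1/2 * (cmod a)\<^sup>2 * r ^ (2 * k)) * (C * exp (1/2 * (r + R)\<^sup>2))"
    by (simp only: exp_add mult_ac)
  then show ?thesis
    by (rule mult_left_le_imp_le) simp
qed

text \<open>A non-zero coefficient of index \<open>k \<ge> 2\<close> would force growth of order
  \<open>r ^ (2 * k)\<close> in an exponent bounded by \<open>(r + R)\<^sup>2 / 2\<close> up to a
  constant; a linear coefficient of modulus above 1 is excluded in the same way.\<close>

lemma affine_if_growth_at_0:
  fixes u \<psi> :: "complex \<Rightarrow> complex" and C R :: real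
  assumes u: "u holomorphic_on UNIV" "u 0 \<noteq> 0" and \<psi>: "\<psi> holomorphic_on UNIV"
    and bound: "\<And>z w. cmod (u z) * cmod w ^ n * exp (Re (cnj w * \<psi> z))
        \<le> C * exp (1/2 * (cmod w)\<^sup>2 + 1/2 * (cmod z + R)\<^sup>2)"
  shows "\<exists>a b. cmod a \<le> 1 \<and> (\<forall>z. \<psi> z = a * z + b)"
proof -
  define a where "a k = (deriv ^^ k) \<psi> 0 / fact k" for k
  have key: "\<exists>D. \<forall>r\<ge>1. exp (1/2 * (cmod (a k))\<^sup>2 * r ^ (2 * k)) \<le> D * exp (1/2 * (1 * r + R)\<^sup>2)"
    if "k \<ge> 1" "a k \<noteq> 0" for k
  proof (intro exI allI impI)
    fix r :: real assume "r \<ge> 1"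
    have "cmod (u 0) * cmod (a k) ^ n * exp (1/2 * (cmod (a k))\<^sup>2 * r ^ (2 * k)) \<le> C * exp (1/2 * (r + R)\<^sup>2)"
      unfolding a_def by (rule Taylor_coeff_growth[OF u(1) \<psi> \<open>r \<ge> 1\<close> bound])
    then show "exp (1/2 * (cmod (a k))\<^sup>2 * r ^ (2 * k)) \<le> C / (cmod (u 0) * cmod (a k) ^ n) * exp (1/2 * (1 * r + R)\<^sup>2)"
      using that u(2) by (simp add: field_simps)
  qed
  have a0: "a k = 0" if k: "k \<ge> 2" for k
  proof (rule ccontr)
    assume ne: "a k \<noteq> 0"
    with k key[of k] obtain D where D: "exp (1/2 * (cmod (a k))\<^sup>2 * r ^ (2 * k)) \<le> D * exp (1/2 * (1 * r + R)\<^sup>2)"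
      if "r \<ge> 1" for r by auto
    \<comment> \<open>From here on the exponent on the left of \<open>D\<close> is at least
      \<open>r\<^sup>2\<close>, which outgrows \<open>(r + R)\<^sup>2 / 2\<close>.\<close>
    have "\<forall>\<^sub>F r in at_top. (cmod (a k))\<^sup>2 * r\<^sup>2 \<ge> 2"
      using ne by real_asymp
    moreover have "\<forall>\<^sub>F r in at_top. D * exp (1/2 * (1 * r + R)\<^sup>2) < exp (2/2 * r\<^sup>2)"
      by (rule eventually_gaussian_dominates) simp
    ultimately have "\<forall>\<^sub>F r::real in at_top. False"
      using eventually_ge_at_top[of 1]
    proof eventually_elim
      case (elim r)
      have "2 * r\<^sup>2 \<le> (cmod (a k))\<^sup>2 * r\<^sup>2 * r\<^sup>2"
        using elim(1) by (intro mult_right_mono) auto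
      also have "\<dots> = (cmod (a k))\<^sup>2 * r ^ 4"
        by (simp add: power4_eq_xxxx power2_eq_square)
      also have "\<dots> \<le> (cmod (a k))\<^sup>2 * r ^ (2 * k)"
        using k elim by (intro mult_left_mono power_increasing) auto
      finally have "exp (2/2 * r\<^sup>2) \<le> exp (1/2 * (cmod (a k))\<^sup>2 * r ^ (2 * k))" by simp
      from less_le_trans[OF elim(2) this] D[OF elim(3)] show False by (metis leD)
    qed
    then show False by simp
  qed
  have "cmod (a 1) \<le> 1"
  proof (rule ccontr)
    assume gt: "\<not> ?thesis"
    then have "a 1 \<noteq> 0" by auto
    with key[of 1] obtain D where D: "exp (1/2 * (cmod (a 1))\<^sup>2 * r ^ 2) \<le> D * exp (1/2 * (1 * r + R)\<^sup>2)"
      if "r \<ge> 1" for r by auto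
    have "\<forall>\<^sub>F r in at_top. D * exp (1/2 * (1 * r + R)\<^sup>2) < exp ((cmod (a 1))\<^sup>2/2 * r\<^sup>2)"
      using gt by (intro eventually_gaussian_dominates) (simp add: power_less_one_iff one_less_power)
    then have "\<forall>\<^sub>F r::real in at_top. False"
      using eventually_ge_at_top[of 1]
    proof eventually_elim
      case (elim r)
      with D[of r] show False by simp
    qed
    then show False by simp
  qed
  moreover have "\<psi> z = a 1 * z + a 0" for z
  proof -
    have "(\<lambda>j. a j * z ^ j) sums (\<Sum>j<2. a j * z ^ j)"
      by (rule sums_finite) (auto simp: a0)
    moreover have "(\<lambda>j. a j * z ^ j) sums \<psi> z"
      unfolding a_def by (rule entire_sums_Taylor[OF \<psi>])
    ultimately have "\<psi> z = (\<Sum>j<2. a j * z ^ j)"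
      using sums_unique2 by blast
    then show ?thesis by (simp add: eval_nat_numeral add.commute)
  qed
  ultimately show ?thesis by blast
qed

text \<open>Translation by \<open>\<zeta>\<close> moves a point with
  \<open>u \<zeta> \<noteq> 0\<close> to the origin. The price is the shift
  \<open>R = cmod \<zeta>\<close> in the growth bound.\<close>

lemma affine_if_growth:
  fixes u \<psi> :: "complex \<Rightarrow> complex" and C :: real
  assumes u: "u holomorphic_on UNIV" "u \<zeta> \<noteq> 0" and \<psi>: "\<psi> holomorphic_on UNIV"
    and bound: "\<And>z w. cmod (u z) * cmod w ^ n * exp (Re (cnj w * \<psi> z))
        \<le> C * exp (1/2 * (cmod w)\<^sup>2 + 1/2 * (cmod z)\<^sup>2)"
  shows "\<exists>a b. cmod a \<le> 1 \<and> (\<forall>z. \<psi> z = a * z + b)"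
proof -
  have C: "C \<ge> 0"
  proof -
    have "0 \<le> cmod (u 0) * cmod 1 ^ n * exp (Re (cnj 1 * \<psi> 0))" by simp
    also note bound[of 0 1]
    finally show ?thesis by (simp add: zero_le_mult_iff)
  qed
  have "\<exists>a b. cmod a \<le> 1 \<and> (\<forall>z. \<psi> (1 * z + \<zeta>) = a * z + b)"
  proof (rule affine_if_growth_at_0)
    show "(\<lambda>z. u (1 * z + \<zeta>)) holomorphic_on UNIV" "(\<lambda>z. \<psi> (1 * z + \<zeta>)) holomorphic_on UNIV"
      by (rule entire_compose_affine; fact)+
    show "u (1 * 0 + \<zeta>) \<noteq> 0" using u by simp
    show "cmod (u (1 * z + \<zeta>)) * cmod w ^ n * exp (Re (cnj w * \<psi> (1 * z + \<zeta>)))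
        \<le> C * exp (1/2 * (cmod w)\<^sup>2 + 1/2 * (cmod z + cmod \<zeta>)\<^sup>2)" for z w
    proof -
      have "(cmod (1 * z + \<zeta>))\<^sup>2 \<le> (cmod z + cmod \<zeta>)\<^sup>2"
        by (intro power_mono) (auto intro: norm_triangle_ineq)
      then have "C * exp (1/2 * (cmod w)\<^sup>2 + 1/2 * (cmod (1 * z + \<zeta>))\<^sup>2) \<le> C * exp (1/2 * (cmod w)\<^sup>2 + 1/2 * (cmod z + cmod \<zeta>)\<^sup>2)"
        using C by (intro mult_left_mono) auto
      with bound[of "1 * z + \<zeta>" w] show ?thesis by linarith
    qed
  qed
  then obtain a b where ab: "cmod a \<le> 1" "\<And>z. \<psi> (1 * z + \<zeta>) = a * z + b"
    by blast
  have "\<psi> z = a * z + (b - a * \<zeta>)" for z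
    using ab(2)[of "z - \<zeta>"] by (simp add: algebra_simps)
  with ab(1) show ?thesis by blast
qed

text \<open>The maximum principle for the entire function \<open>1 / u\<close>; the point is a
  minimum of \<open>cmod (u z)\<close> on the circle.\<close>

lemma nonvanishing_entire_le_on_circle:
  fixes u :: "complex \<Rightarrow> complex"
  assumes u: "u holomorphic_on UNIV" "\<And>z. u z \<noteq> 0" and r: "r > 0"
  obtains z where "cmod z = r" "cmod (u z) \<le> cmod (u 0)"
proof -
  have cu: "continuous_on A u" for A
    using u by (meson holomorphic_on_imp_continuous_on holomorphic_on_subset subset_UNIV)
  have "\<exists>z\<in>sphere 0 r. \<forall>w\<in>sphere 0 r. cmod (u z) \<le> cmod (u w)"
    using r by (intro continuous_attains_inf continuous_intros cu) auto
  then obtain z where z: "cmod z = r" "\<And>w. cmod w = r \<Longrightarrow> cmod (u z) \<le> cmod (u w)"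
    by auto
  have "cmod (1 / u 0) \<le> 1 / cmod (u z)"
  proof (rule maximum_modulus_frontier[of "\<lambda>w. 1 / u w" "cball 0 r"])
    show "(\<lambda>w. 1 / u w) holomorphic_on interior (cball 0 r)"
      using u by (intro holomorphic_intros) (auto intro: holomorphic_on_subset)
    show "continuous_on (closure (cball 0 r)) (\<lambda>w. 1 / u w)"
      using u by (intro continuous_intros cu) auto
    show "cmod (1 / u w) \<le> 1 / cmod (u z)" if "w \<in> frontier (cball 0 r)" for w
      using that r z(2)[of w] u by (auto simp: frontier_cball norm_divide intro!: divide_left_mono)
  qed (use r in auto)
  then have "cmod (u z) \<le> cmod (u 0)"
    using u by (simp add: norm_divide divide_simps)
  with z that show ?thesis by blast
qed

section \<open>The equivalence\<close>

text \<open>Since the kernels share the norm \<open>N\<close>, one constant bounds the norms of all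
  their images, and point evaluation makes this explicit. Differentiating a kernel \<open>n\<close>
  times produces the factor \<open>cnj w ^ n\<close>.\<close>

lemma bounded_wcomp_diff_coherent_bound:
  assumes p: "1 \<le> p" and bdd: "bounded_on_fock p (wcomp_diff u \<psi> n)"
  obtains C where "\<And>z w. cmod (u z) * cmod w ^ n * exp (Re (cnj w * \<psi> z))
        \<le> C * exp (1/2 * (cmod w)\<^sup>2 + 1/2 * (cmod z)\<^sup>2)"
proof -
  define k where "k w z = exp (cnj w * z - of_real ((cmod w)\<^sup>2 / 2))" for w z :: complex
  define N where "N = weighted_norm p (\<lambda>z. exp (- (1/2) * (cmod z)\<^sup>2))"
  have N: "N < top"
    unfolding N_def by (intro weighted_norm_gaussian_finite p) simp
  obtain c where c: "\<And>f. f \<in> fock_space p \<Longrightarrow> fock_norm p (wcomp_diff u \<psi> n f) \<le> ennreal c * fock_norm p f"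
    using bdd unfolding bounded_on_fock_def by blast
  define M where "M = enn2real (ennreal c * N)"
  have M: "M \<ge> 0" "ennreal c * N = ennreal M"
    using N by (simp_all add: M_def ennreal_mult_less_top)
  obtain K where K: "\<And>f M z. f holomorphic_on UNIV \<Longrightarrow> M \<ge> 0 \<Longrightarrow> fock_norm p f \<le> ennreal M \<Longrightarrow> gweight f z \<le> K * M"
    using gweight_le_fock_norm[OF p] by blast
  have "cmod (u z) * cmod w ^ n * exp (Re (cnj w * \<psi> z))
        \<le> K * M * exp (1/2 * (cmod w)\<^sup>2 + 1/2 * (cmod z)\<^sup>2)" for z w
  proof -
    have kw: "k w \<in> fock_space p" "fock_norm p (k w) = N"
      unfolding k_def N_def by (rule fock_space_coherent[OF p] fock_norm_coherent[OF p])+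
    then have "wcomp_diff u \<psi> n (k w) holomorphic_on UNIV"
      using bdd by (auto simp: bounded_on_fock_def fock_space_def)
    then have "gweight (wcomp_diff u \<psi> n (k w)) z \<le> K * M"
      using c[OF kw(1)] M kw(2) by (intro K) auto
    moreover have "gweight (wcomp_diff u \<psi> n (k w)) z
        = cmod (u z) * cmod w ^ n * exp (Re (cnj w * \<psi> z)) * exp (- (1/2 * (cmod w)\<^sup>2 + 1/2 * (cmod z)\<^sup>2))"
    proof -
      have "exp (Re (cnj w * \<psi> z - of_real ((cmod w)\<^sup>2 / 2))) * exp (- (1/2) * (cmod z)\<^sup>2)
          = exp (Re (cnj w * \<psi> z)) * exp (- (1/2 * (cmod w)\<^sup>2 + 1/2 * (cmod z)\<^sup>2))"
        unfolding exp_add[symmetric] by (simp add: algebra_simps)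
      then show ?thesis
        unfolding k_def gweight_def wcomp_diff_def higher_deriv_exp_affine
        by (simp only: norm_mult norm_power complex_mod_cnj norm_exp_eq_Re mult.assoc)
    qed
    ultimately show ?thesis
      by (simp add: exp_minus field_simps)
  qed
  then show ?thesis by (rule that)
qed

section \<open>The case of a unimodular slope\<close>

text \<open>For \<open>cmod a = 1\<close> the difference of squares is twice the real part of an
  affine function, so \<open>L\<close> is the modulus of an entire function \<open>E\<close>. The
  choice \<open>w = a * z + b\<close> bounds \<open>E\<close>, and Liouville's theorem makes it
  constant.\<close>

lemma unimodular_weight_const:
  fixes u :: "complex \<Rightarrow> complex"
  assumes u: "u holomorphic_on UNIV" "u \<zeta> \<noteq> 0" and a: "cmod a = 1"
    and bound: "\<And>z w. cmod (u z) * cmod w ^ n * exp (Re (cnj w * (a * z + b)))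
        \<le> C * exp (1/2 * (cmod w)\<^sup>2 + 1/2 * (cmod z)\<^sup>2)"
  obtains \<kappa> where "n = 0" "\<kappa> > 0" "\<And>z. cmod (u z) * exp (1/2 * ((cmod (a * z + b))\<^sup>2 - (cmod z)\<^sup>2)) = \<kappa>"
proof -
  define E where "E z = u z * (a * z + b) ^ n * exp (a * cnj b * z + of_real ((cmod b)\<^sup>2 / 2))" for z
  have E: "E holomorphic_on UNIV"
    unfolding E_def by (intro holomorphic_intros u)
  have a0: "a \<noteq> 0" using a by auto
  have sq: "(cmod (a * z + b))\<^sup>2 - (cmod z)\<^sup>2 = 2 * Re (a * cnj b * z + of_real ((cmod b)\<^sup>2 / 2))" for z
  proof -
    have "(cmod (a * z + b))\<^sup>2 = (cmod (a * z))\<^sup>2 + 2 * Re (a * z * cnj b) + (cmod b)\<^sup>2"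
      unfolding cmod_power2 by (simp add: algebra_simps power2_eq_square)
    then show ?thesis
      using a by (simp add: norm_mult algebra_simps)
  qed
  have cE: "cmod (E z) = cmod (u z) * cmod (a * z + b) ^ n * exp (1/2 * ((cmod (a * z + b))\<^sup>2 - (cmod z)\<^sup>2))" for z
    unfolding sq by (simp add: E_def norm_mult norm_power norm_exp_eq_Re)
  have le: "cmod (E z) \<le> C" for z
  proof -
    have *: "Re (cnj w * w) = (cmod w)\<^sup>2" for w
      unfolding cmod_power2 by (simp add: power2_eq_square)
    have "cmod (u z) * cmod (a * z + b) ^ n * exp ((cmod (a * z + b))\<^sup>2)
        \<le> C * exp (1/2 * (cmod (a * z + b))\<^sup>2 + 1/2 * (cmod z)\<^sup>2)"
      using bound[of z "a * z + b"] unfolding * .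
    then have "cmod (u z) * cmod (a * z + b) ^ n * exp ((cmod (a * z + b))\<^sup>2) / exp (1/2 * (cmod (a * z + b))\<^sup>2 + 1/2 * (cmod z)\<^sup>2) \<le> C"
      by (simp add: divide_le_eq)
    moreover have "exp ((cmod (a * z + b))\<^sup>2) / exp (1/2 * (cmod (a * z + b))\<^sup>2 + 1/2 * (cmod z)\<^sup>2) = exp (1/2 * ((cmod (a * z + b))\<^sup>2 - (cmod z)\<^sup>2))"
      unfolding exp_diff[symmetric] by (simp add: field_simps)
    ultimately show ?thesis
      unfolding cE by (metis times_divide_eq_right)
  qed
  have "bounded (range E)"
    using le by (auto simp: bounded_iff)
  with E obtain e where e: "\<And>z. E z = e"
    using Liouville_theorem by (metis constant_on_def UNIV_I)
  \<comment> \<open>Otherwise \<open>u\<close> vanishes off the point \<open>- b / a\<close>, hence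
    everywhere by continuity.\<close>
  have "e \<noteq> 0"
  proof
    assume "e = 0"
    then have uz: "u z = 0" if "z \<noteq> - b / a" for z
      using e[of z] that a0 by (auto simp: E_def eq_neg_iff_add_eq_0 field_simps)
    have "\<zeta> \<in> closure (- {- b / a})"
      by (simp add: closure_complement)
    moreover have "continuous_on (closure (- {- b / a})) u"
      using u(1) by (meson holomorphic_on_imp_continuous_on holomorphic_on_subset subset_UNIV)
    ultimately have "u \<zeta> = 0"
      using continuous_constant_on_closure[of "- {- b / a}" u 0 \<zeta>] uz by auto
    with u show False by simp
  qed
  \<comment> \<open>A positive \<open>n\<close> would give the non-zero constant \<open>E\<close> a
    zero at \<open>- b / a\<close>.\<close>
  have n: "n = 0"
  proof (rule ccontr)
    assume "n \<noteq> 0"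
    then have "E (- b / a) = 0" using a0 by (simp add: E_def)
    with e \<open>e \<noteq> 0\<close> show False by simp
  qed
  have "cmod (u z) * exp (1/2 * ((cmod (a * z + b))\<^sup>2 - (cmod z)\<^sup>2)) = cmod e" for z
    using cE[of z] e[of z] n by simp
  with n \<open>e \<noteq> 0\<close> show ?thesis by (intro that[of "cmod e"]) auto
qed

text \<open>The preimage of \<open>g\<close> is \<open>g / u\<close> composed with the inverse
  affine map. By constancy of the weight, its weighted modulus is that of \<open>g\<close>, moved by
  an isometry and divided by \<open>\<kappa>\<close>.\<close>

lemma surjective_if_unimodular:
  assumes p: "1 \<le> p" and u: "u holomorphic_on UNIV" and a: "cmod a = 1" and \<kappa>: "\<kappa> > 0"
    and const: "\<And>z. cmod (u z) * exp (1/2 * ((cmod (a * z + b))\<^sup>2 - (cmod z)\<^sup>2)) = \<kappa>"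
    and bdd: "bounded_on_fock p (wcomp_diff u (\<lambda>z. a * z + b) 0)"
  shows "surjective_on_fock p (wcomp_diff u (\<lambda>z. a * z + b) 0)"
proof -
  have a0: "a \<noteq> 0" using a by auto
  have u0: "u z \<noteq> 0" for z
    using const[of z] \<kappa> by auto
  have "g \<in> wcomp_diff u (\<lambda>z. a * z + b) 0 ` fock_space p" if g: "g \<in> fock_space p" for g
  proof
    define f where "f w = g (1 / a * w + - b / a) / u (1 / a * w + - b / a)" for w
    have gh: "g holomorphic_on UNIV" using g by (simp add: fock_space_def)
    have inv: "1 / a * (a * z + b) + - b / a = z" "a * (1 / a * w + - b / a) + b = w" for z w
      using a0 by (simp_all add: field_simps)
    show "g = wcomp_diff u (\<lambda>z. a * z + b) 0 f"
      by (rule ext) (simp only: wcomp_diff_def funpow_0 f_def inv, simp add: u0)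
    have gwg: "gweight f w = 1 / \<kappa> * gweight g (1 / a * w + - b / a)" for w
    proof -
      define z where "z = 1 / a * w + - b / a"
      have w: "a * z + b = w" unfolding z_def by (rule inv)
      have "f w = g z / u z" by (simp only: f_def z_def)
      moreover have "exp (- (1/2) * (cmod w)\<^sup>2) = exp (- (1/2) * (cmod z)\<^sup>2) / exp (1/2 * ((cmod w)\<^sup>2 - (cmod z)\<^sup>2))"
        by (simp add: field_simps flip: exp_diff)
      ultimately have "gweight f w = cmod (g z) * exp (- (1/2) * (cmod z)\<^sup>2) / (cmod (u z) * exp (1/2 * ((cmod w)\<^sup>2 - (cmod z)\<^sup>2)))"
        by (simp add: gweight_def norm_divide)
      also have "\<dots> = 1 / \<kappa> * gweight g z"
        using const[of z] unfolding w by (simp add: gweight_def)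
      finally show ?thesis unfolding z_def .
    qed
    have [measurable]: "gweight g \<in> borel_measurable borel"
      by (rule gweight_measurable[OF gh])
    have "weighted_norm p (gweight f) < top"
    proof (rule weighted_norm_finite_mono[OF p])
      show "gweight f w \<le> 1 / \<kappa> * gweight g (1 / a * w + - b / a)" for w
        by (simp only: gwg order_refl)
      show "weighted_norm p (\<lambda>w. gweight g (1 / a * w + - b / a)) < top"
        using g a by (subst weighted_norm_isometry[OF p])
          (auto simp: norm_divide fock_space_def fock_norm_eq_weighted_norm)
      show "(\<lambda>w. gweight g (1 / a * w + - b / a)) \<in> borel_measurable borel"
        by measurable
    qed (use \<kappa> in auto)
    moreover have "f holomorphic_on UNIV"
      unfolding f_def using u0 by (intro holomorphic_intros entire_compose_affine gh u)
    ultimately show "f \<in> fock_space p"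
      by (simp add: fock_space_def fock_norm_eq_weighted_norm)
  qed
  with bdd show ?thesis
    unfolding surjective_on_fock_def bounded_on_fock_def by blast
qed

section \<open>The case of slope less than one in modulus\<close>

lemma not_ess_bounded_away_from_zero:
  assumes u: "u holomorphic_on UNIV" and a: "a \<noteq> 0" "cmod a < 1"
  shows "\<not> ess_bounded_away_from_zero (L_fun u (\<lambda>z. a * z + b) n)"
proof
  assume "ess_bounded_away_from_zero (L_fun u (\<lambda>z. a * z + b) n)"
  then obtain \<delta> where \<delta>: "\<delta> > 0" and null: "{z. \<bar>L_fun u (\<lambda>z. a * z + b) n z\<bar> < \<delta>} \<in> null_sets lebesgue"
    unfolding ess_bounded_away_from_zero_def by blast
  have cu: "continuous_on UNIV u"
    using u by (rule holomorphic_on_imp_continuous_on)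
  \<comment> \<open>An open null set is empty, so continuity of \<open>L\<close> turns the essential
    lower bound into a pointwise one.\<close>
  have "open {z. \<bar>L_fun u (\<lambda>z. a * z + b) n z\<bar> < \<delta>}"
    unfolding L_fun_def by (intro open_Collect_less continuous_intros cu)
  with null have empty: "{z. \<bar>L_fun u (\<lambda>z. a * z + b) n z\<bar> < \<delta>} = {}"
    using open_not_negligible negligible_iff_null_sets by blast
  have L: "\<delta> \<le> L_fun u (\<lambda>z. a * z + b) n z" for z
  proof -
    have "L_fun u (\<lambda>z. a * z + b) n z \<ge> 0" by (simp add: L_fun_def)
    moreover have "\<not> \<bar>L_fun u (\<lambda>z. a * z + b) n z\<bar> < \<delta>" using empty by blast
    ultimately show ?thesis by simp
  qed
  \<comment> \<open>For positive \<open>n\<close>, \<open>L\<close> would vanish at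
    \<open>- b / a\<close>.\<close>
  have n: "n = 0"
    using L[of "- b / a"] a \<delta> by (cases n) (auto simp: L_fun_def)
  have u0: "u z \<noteq> 0" for z
    using L[of z] \<delta> by (auto simp: L_fun_def)
  have "(cmod a)\<^sup>2 < 1"
    using a by (simp add: power_less_one_iff abs_square_less_1)
  then have "\<forall>\<^sub>F r in at_top. (cmod (u 0) / \<delta>) * exp (1/2 * (cmod a * r + cmod b)\<^sup>2) < exp (1/2 * r\<^sup>2)"
    by (rule eventually_gaussian_dominates)
  then have "\<forall>\<^sub>F r::real in at_top. False"
    using eventually_gt_at_top[of 0]
  proof eventually_elim
    case (elim r)
    obtain z where z: "cmod z = r" "cmod (u z) \<le> cmod (u 0)"
      using nonvanishing_entire_le_on_circle[OF u u0 elim(2)] by blast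
    have "cmod (a * z + b) \<le> cmod a * r + cmod b"
      using norm_triangle_ineq[of "a * z" b] z by (simp add: norm_mult)
    then have sq: "(cmod (a * z + b))\<^sup>2 \<le> (cmod a * r + cmod b)\<^sup>2"
      by (intro power_mono) auto
    have "\<delta> * exp (1/2 * r\<^sup>2) \<le> L_fun u (\<lambda>z. a * z + b) n z * exp (1/2 * r\<^sup>2)"
      by (intro mult_right_mono L) simp
    also have "\<dots> = cmod (u z) * exp (1/2 * ((cmod (a * z + b))\<^sup>2 - r\<^sup>2) + 1/2 * r\<^sup>2)"
      unfolding exp_add using z n by (simp add: L_fun_def)
    also have "\<dots> = cmod (u z) * exp (1/2 * (cmod (a * z + b))\<^sup>2)"
      by (simp add: algebra_simps)
    also have "\<dots> \<le> cmod (u 0) * exp (1/2 * (cmod a * r + cmod b)\<^sup>2)"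
      by (rule mult_mono) (use z sq in auto)
    finally show False
      using elim(1) \<delta> by (simp add: field_simps)
  qed
  then show False by simp
qed

text \<open>Cauchy's inequality on circles of radius 1, whence the shift \<open>cmod w + 1\<close>;
  the quadratic growth rate of the exponent is unchanged.\<close>

lemma higher_deriv_fock_bound:
  assumes p: "1 \<le> p" and f: "f \<in> fock_space p"
  obtains B where "\<And>w. cmod ((deriv ^^ n) f w) \<le> B * exp (1/2 * (cmod w + 1)\<^sup>2)"
proof -
  obtain B where B: "\<And>z. gweight f z \<le> B"
    using fock_norm_finite_gweight_le[OF p f] by blast
  have fh: "f holomorphic_on UNIV" using f by (simp add: fock_space_def)
  have "B \<ge> 0" using B[of 0] gweight_nonneg[of f 0] by linarith
  have "cmod ((deriv ^^ n) f w) \<le> fact n * B * exp (1/2 * (cmod w + 1)\<^sup>2)" for w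
  proof -
    have "cmod ((deriv ^^ n) f w) \<le> fact n * (B * exp (1/2 * (cmod w + 1)\<^sup>2)) / 1 ^ n"
    proof (rule Cauchy_inequality)
      show "f holomorphic_on ball w 1" "continuous_on (cball w 1) f"
        using fh by (auto intro: holomorphic_on_subset holomorphic_on_imp_continuous_on)
      show "cmod (f z) \<le> B * exp (1/2 * (cmod w + 1)\<^sup>2)" if "cmod (w - z) = 1" for z
      proof -
        have "cmod z \<le> cmod w + 1"
          using that norm_triangle_sub[of z w] by (simp add: norm_minus_commute)
        then have "(cmod z)\<^sup>2 \<le> (cmod w + 1)\<^sup>2" by (intro power_mono) auto
        have "cmod (f z) \<le> B * exp (1/2 * (cmod z)\<^sup>2)"
          using B[of z] by (simp add: gweight_def exp_minus field_simps)
        also have "\<dots> \<le> B * exp (1/2 * (cmod w + 1)\<^sup>2)"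
          using \<open>B \<ge> 0\<close> \<open>(cmod z)\<^sup>2 \<le> (cmod w + 1)\<^sup>2\<close> by (intro mult_left_mono) auto
        finally show ?thesis .
      qed
    qed auto
    then show ?thesis by (simp add: mult.assoc)
  qed
  then show ?thesis by (rule that)
qed

text \<open>Tests surjectivity on a Gaussian that is large along a direction in which \<open>u\<close> stays bounded.\<close>

lemma not_surjective_on_fock:
  assumes p: "1 \<le> p" and u: "u holomorphic_on UNIV" and a: "cmod a < 1"
  shows "\<not> surjective_on_fock p (wcomp_diff u (\<lambda>z. a * z + b) n)"
proof
  assume surj: "surjective_on_fock p (wcomp_diff u (\<lambda>z. a * z + b) n)"
  then have pre: "\<exists>f\<in>fock_space p. g = wcomp_diff u (\<lambda>z. a * z + b) n f" if "g \<in> fock_space p" for g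
    using that unfolding surjective_on_fock_def by blast
  \<comment> \<open>A preimage of the constant 1 shows that \<open>u\<close> has no zeros.\<close>
  have "(\<lambda>_. 1) \<in> fock_space p"
    by (rule fock_space_if_gaussian_bound[OF p, of _ 0]) auto
  from pre[OF this] obtain f where f1: "(\<lambda>_. 1) = wcomp_diff u (\<lambda>z. a * z + b) n f"
    by blast
  have u0: "u z \<noteq> 0" for z
    using fun_cong[OF f1, of z] by (auto simp: wcomp_diff_def)
  have "\<exists>z. cmod z = real (Suc k) \<and> cmod (u z) \<le> cmod (u 0)" for k
    using nonvanishing_entire_le_on_circle[OF u u0, of "real (Suc k)"] by force
  then obtain Z where Z: "\<And>k. cmod (Z k) = real (Suc k)" "\<And>k. cmod (u (Z k)) \<le> cmod (u 0)"
    by metis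
  define X where "X k = Z k / of_nat (Suc k)" for k
  have X: "cmod (X k) = 1" "Z k = of_nat (Suc k) * X k" for k
    using Z(1)[of k] by (simp_all add: X_def norm_divide del: of_nat_Suc)
  have "compact (sphere (0::complex) 1)" by simp
  moreover have "\<forall>k. X k \<in> sphere 0 1" using X by simp
  ultimately obtain \<rho> s where \<rho>: "\<rho> \<in> sphere 0 1" and s: "strict_mono (s :: nat \<Rightarrow> nat)" and lim: "(X \<circ> s) \<longlonglongrightarrow> \<rho>"
    unfolding compact_def by blast
  \<comment> \<open>Two values with \<open>(cmod a)\<^sup>2 < c' < c < 1\<close>:
    \<open>c < 1\<close> puts \<open>g\<close> into the Fock space, the gap between
    \<open>c'\<close> and \<open>c\<close> absorbs the deviation of the directions
    \<open>X (s k)\<close> from \<open>\<rho>\<close>, and \<open>c'\<close> still beats the growth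
    of the derivative along the image points.\<close>
  define c' where "c' = (2 * (cmod a)\<^sup>2 + 1) / 3"
  define c where "c = ((cmod a)\<^sup>2 + 2) / 3"
  have "(cmod a)\<^sup>2 < 1"
    using a by (simp add: power_less_one_iff abs_square_less_1)
  then have c: "(cmod a)\<^sup>2 < c'" "c' < c" "c < 1" "0 \<le> c"
    by (auto simp: c_def c'_def field_simps)
  define g where "g z = exp (of_real (c / 2) * (cnj \<rho> * z)\<^sup>2)" for z
  have "g \<in> fock_space p"
  proof (rule fock_space_if_gaussian_bound[OF p _ c(3)])
    show "cmod (g z) \<le> exp (c / 2 * (cmod z)\<^sup>2)" for z
    proof -
      have "Re ((cnj \<rho> * z)\<^sup>2) \<le> cmod ((cnj \<rho> * z)\<^sup>2)" by (rule complex_Re_le_cmod)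
      also have "\<dots> = (cmod z)\<^sup>2" using \<rho> by (simp add: norm_power norm_mult)
      finally have "c / 2 * Re ((cnj \<rho> * z)\<^sup>2) \<le> c / 2 * (cmod z)\<^sup>2"
        using c by (intro mult_left_mono) auto
      then show ?thesis by (simp add: g_def norm_exp_eq_Re)
    qed
    show "g holomorphic_on UNIV"
      unfolding g_def by (intro holomorphic_intros)
  qed
  from pre[OF this] obtain f where f: "f \<in> fock_space p" and gf: "g = wcomp_diff u (\<lambda>z. a * z + b) n f"
    by blast
  obtain B where B: "\<And>w. cmod ((deriv ^^ n) f w) \<le> B * exp (1/2 * (cmod w + 1)\<^sup>2)"
    using higher_deriv_fock_bound[OF p f] by blast
  have "0 \<le> B * exp (1/2 * (cmod 0 + 1)\<^sup>2)"
    using B[of 0] norm_ge_zero order_trans by blast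
  then have "B \<ge> 0" by (simp add: zero_le_mult_iff)
  define r where "r k = real (Suc (s k))" for k
  have "\<forall>\<^sub>F r in at_top. (cmod (u 0) * B) * exp (1/2 * (cmod a * r + (cmod b + 1))\<^sup>2) < exp (c'/2 * r\<^sup>2)"
    using c(1) by (rule eventually_gaussian_dominates)
  moreover have "filterlim r at_top sequentially"
    unfolding r_def
    by (intro filterlim_compose[OF filterlim_real_sequentially] filterlim_compose[OF filterlim_Suc] filterlim_subseq s)
  ultimately have ev: "\<forall>\<^sub>F k in sequentially. (cmod (u 0) * B) * exp (1/2 * (cmod a * r k + (cmod b + 1))\<^sup>2) < exp (c'/2 * (r k)\<^sup>2)"
    by (rule eventually_compose_filterlim)
  \<comment> \<open>The growth rate of \<open>g\<close> in the direction \<open>X (s k)\<close>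
    tends to the maximal rate \<open>c\<close>, so it eventually exceeds \<open>c'\<close>.\<close>
  have "(\<lambda>k. c * Re ((cnj \<rho> * (X \<circ> s) k)\<^sup>2)) \<longlonglongrightarrow> c * Re ((cnj \<rho> * \<rho>)\<^sup>2)"
    by (intro tendsto_intros lim)
  moreover have "cnj \<rho> * \<rho> = 1"
    using \<rho> complex_norm_square[of \<rho>] by (simp add: mult.commute)
  ultimately have "(\<lambda>k. c * Re ((cnj \<rho> * X (s k))\<^sup>2)) \<longlonglongrightarrow> c"
    by simp
  then have "\<forall>\<^sub>F k in sequentially. c' < c * Re ((cnj \<rho> * X (s k))\<^sup>2)"
    using c(2) by (rule order_tendstoD)
  with ev have "\<forall>\<^sub>F k in sequentially. False"
  proof eventually_elim
    case (elim k)
    define z where "z = Z (s k)"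
    have z: "cmod z = r k" "cmod (u z) \<le> cmod (u 0)" "z = of_real (r k) * X (s k)"
      unfolding z_def r_def using Z X by auto
    have "Re ((cnj \<rho> * z)\<^sup>2) = (r k)\<^sup>2 * Re ((cnj \<rho> * X (s k))\<^sup>2)"
      by (simp add: z(3) power_mult_distrib algebra_simps flip: of_real_power)
    then have "cmod (g z) = exp (c * Re ((cnj \<rho> * X (s k))\<^sup>2) / 2 * (r k)\<^sup>2)"
      by (simp add: g_def norm_exp_eq_Re mult_ac)
    moreover have "c' / 2 * (r k)\<^sup>2 \<le> c * Re ((cnj \<rho> * X (s k))\<^sup>2) / 2 * (r k)\<^sup>2"
      using elim(2) by (intro mult_right_mono) auto
    ultimately have "exp (c' / 2 * (r k)\<^sup>2) \<le> cmod (g z)" by simp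
    also have "\<dots> = cmod (u z) * cmod ((deriv ^^ n) f (a * z + b))"
      by (simp add: gf wcomp_diff_def norm_mult)
    also have "\<dots> \<le> cmod (u 0) * (B * exp (1/2 * (cmod a * r k + (cmod b + 1))\<^sup>2))"
    proof (rule mult_mono)
      have "cmod (a * z + b) + 1 \<le> cmod a * r k + (cmod b + 1)"
        using norm_triangle_ineq[of "a * z" b] z by (simp add: norm_mult)
      then have "(cmod (a * z + b) + 1)\<^sup>2 \<le> (cmod a * r k + (cmod b + 1))\<^sup>2"
        by (intro power_mono) auto
      then have "B * exp (1/2 * (cmod (a * z + b) + 1)\<^sup>2) \<le> B * exp (1/2 * (cmod a * r k + (cmod b + 1))\<^sup>2)"
        using \<open>B \<ge> 0\<close> by (intro mult_left_mono) auto
      with B[of "a * z + b"] show "cmod ((deriv ^^ n) f (a * z + b)) \<le> B * exp (1/2 * (cmod a * r k + (cmod b + 1))\<^sup>2)"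
        by linarith
    qed (use z in auto)
    finally show False
      using elim(1) by (simp add: mult.assoc)
  qed
  then show False by simp
qed

theorem theorem1p11:
  fixes u \<psi> :: "complex \<Rightarrow> complex" and p :: ennreal and n :: nat
  assumes "u holomorphic_on UNIV" and "\<exists>z. u z \<noteq> 0"
    and "\<psi> holomorphic_on UNIV" and "\<not> \<psi> constant_on UNIV"
    and "1 \<le> p"
    and "bounded_on_fock p (wcomp_diff u \<psi> n)"
  shows "\<exists>a b. (\<forall>z. \<psi> z = a * z + b) \<and> norm a \<le> 1 \<and>
           (ess_bounded_away_from_zero (L_fun u \<psi> n) \<longleftrightarrow>
              surjective_on_fock p (wcomp_diff u \<psi> n)) \<and>
           (surjective_on_fock p (wcomp_diff u \<psi> n) \<longleftrightarrow> norm a = 1)"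
proof -
  note u = assms(1) and p = assms(5) and bdd = assms(6)
  obtain \<zeta> where \<zeta>: "u \<zeta> \<noteq> 0" using assms(2) by blast
  obtain C where C: "\<And>z w. cmod (u z) * cmod w ^ n * exp (Re (cnj w * \<psi> z))
        \<le> C * exp (1/2 * (cmod w)\<^sup>2 + 1/2 * (cmod z)\<^sup>2)"
    using bounded_wcomp_diff_coherent_bound[OF p bdd] by blast
  obtain a b where ab: "cmod a \<le> 1" "\<And>z. \<psi> z = a * z + b"
    using affine_if_growth[OF u \<zeta> assms(3) C] by blast
  have \<psi>: "\<psi> = (\<lambda>z. a * z + b)" using ab(2) by blast
  have "a \<noteq> 0"
    using assms(4) ab(2) by (auto simp: constant_on_def)
  \<comment> \<open>Both properties hold for slope of modulus 1 and both fail below 1, which gives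
    the two equivalences because \<open>cmod a \<le> 1\<close>.\<close>
  have "ess_bounded_away_from_zero (L_fun u \<psi> n) \<and> surjective_on_fock p (wcomp_diff u \<psi> n)" if a: "cmod a = 1"
  proof -
    obtain \<kappa> where \<kappa>: "n = 0" "\<kappa> > 0" "\<And>z. cmod (u z) * exp (1/2 * ((cmod (a * z + b))\<^sup>2 - (cmod z)\<^sup>2)) = \<kappa>"
      using unimodular_weight_const[OF u \<zeta> a C[unfolded \<psi>]] by blast
    have "L_fun u \<psi> n z = \<kappa>" for z
      using \<kappa>(3)[of z] by (simp add: L_fun_def \<psi> \<kappa>(1))
    then have "ess_bounded_away_from_zero (L_fun u \<psi> n)"
      unfolding ess_bounded_away_from_zero_def using \<kappa>(2) by (intro exI[of _ \<kappa>]) auto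
    moreover have "surjective_on_fock p (wcomp_diff u \<psi> n)"
      using surjective_if_unimodular[OF p u a \<kappa>(2,3)] bdd unfolding \<psi> \<kappa>(1) by blast
    ultimately show ?thesis by blast
  qed
  moreover have "\<not> ess_bounded_away_from_zero (L_fun u \<psi> n) \<and> \<not> surjective_on_fock p (wcomp_diff u \<psi> n)"
    if "cmod a < 1"
    unfolding \<psi> using not_ess_bounded_away_from_zero[OF u \<open>a \<noteq> 0\<close> that] not_surjective_on_fock[OF p u that] by blast
  ultimately show ?thesis
    using ab by (intro exI[of _ a] exI[of _ b]) (auto simp: le_less)
qed

end
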